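(* Let $t\ge2$, $n\ge1$, $\omega$ a primitive $t$-th root of unity, $X=(x_1,\dots,x_n)$, $X^t=(x_1^t,\dots,x_n^t)$, $\overline{X}^t=(x_1^{-t},\dots,x_n^{-t})$. Let $\lambda$ be a partition with $\ell(\lambda)\le tn$, with $n_i=n_i(\lambda,tn)$ and $t$-quotient $(\lambda^{(0)},\dots,\lambda^{(t-1)})$ computed with $m=tn$. Consider the symplectic character $\mathrm{sp}_\lambda$ in the $tn$ variables $(X,\omega X,\dots,\omega^{t-1}X)$. (1) If the $t$-core of $\lambda$ is not a symplectic $t$-core, then $\mathrm{sp}_\lambda(X,\omega X,\dots,\omega^{t-1}X)=0$. (2) If the $t$-core of $\lambda$ is a symplectic $t$-core of rank $r$, then \[ \mathrm{sp}_\lambda(X,\omega X,\dots,\omega^{t-1}X)=(-1)^{\epsilon}\operatorname{sgn}(\sigma_\lambda)\,\mathrm{sp}_{\lambda^{(t-1)}}(X^t)\prod_{i=0}^{\lfloor (t-3)/2\rfloor} s_{\mu^{(1)}_i}(X^t,\overline{X}^t)\times\begin{cases}\mathrm{so}_{\lambda^{(t/2-1)}}(X^t)& t\text{ even},\\ 1 & t\text{ odd},\end{cases} \] where $\epsilon=-\sum_{i=\lfloor t/2\rfloor}^{t-2}\binom{n_i+1}{2}+\begin{cases}\frac{n(n+1)}2+nr & t\text{ even},\\ 0& t\text{ odd},\end{cases}$ and, for $0\le i\le\lfloor(t-3)/2\rfloor$, $\mu^{(1)}_i$ is the sequence of length $2n$ whose $j$-th entry is $\lambda^{(t-2-i)}_1+\lambda^{(i)}_j$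 for $1\le j\le n_i$ and $\lambda^{(t-2-i)}_1-\lambda^{(t-2-i)}_{2n+1-j}$ for $n_i<j\le 2n$ (i.e. $\lambda^{(t-2-i)}_1+(\lambda^{(i)},-\mathrm{rev}(\lambda^{(t-2-i)}))$).
   Context: Beta sets and $t$-quotients: for $\ell(\lambda)\le m$, $\beta(\lambda,m)=(\lambda_j+m-j)_{j=1}^m$; $n_i(\lambda,m)$ is the number of entries congruent to $i$ mod $t$; writing those entries in decreasing order as $t\tilde\beta^{(i)}_j+i$ ($1\le j\le n_i$), $\lambda^{(i)}$ is the partition with $n_i$ parts (possibly zero) $\lambda^{(i)}_j=\tilde\beta^{(i)}_j-n_i+j$. The $t$-core is obtained by successively removing border strips of size $t$. Frobenius coordinates: if $\rho$ has rank $k$ (largest $k$ with $\rho_k\ge k$), $\rho=(\alpha|\beta)$ with $\alpha_i=\rho_i-i$, $\beta_i=\rho'_i-i$ ($\rho'$ the conjugate). A partition is symplectic if it is of the form $(\alpha|\alpha+1)$, i.e. $\beta_i=\alpha_i+1$ for all $i$ (the empty partition included); a symplectic $t$-core is a symplectic partition that is a $t$-core. $\sigma_\lambda\in S_{tn}$ is the permutation such that $(\beta_{\sigma_\lambda(1)},\dots,\beta_{\sigma_\lambda(tn)})$ (with $\beta=\beta(\lambda,tn)$) lists the entries congruent to $0$ mod $t$ in decreasing order, then those congruent to $1$, ..., then those congruent to $t-1$. Characters in $N$ variables $y=(y_1,\dots,y_N)$, for a weakly decreasing integer sequence $\mu$ of length $N$: $s_\mu(y)=\det(y_i^{\mu_j+N-j})/\det(y_i^{N-j})$;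 $\mathrm{sp}_\mu(y)=\det(y_i^{\mu_j+N-j+1}-y_i^{-(\mu_j+N-j+1)})/\det(y_i^{N-j+1}-y_i^{-(N-j+1)})$; $\mathrm{so}_\mu(y)=\det(y_i^{\mu_j+N-j+1}-y_i^{-(\mu_j+N-j)})/\det(y_i^{N-j+1}-y_i^{-(N-j)})$ (all determinants $N\times N$). Here $\mathrm{sp}_{\lambda^{(t-1)}}$ and $\mathrm{so}_{\lambda^{(t/2-1)}}$ are in $n$ variables, $s_{\mu^{(1)}_i}$ in the $2n$ variables $(X^t,\overline{X}^t)$. *)

theory Defs
  imports "Jordan_Normal_Form.Determinant" "HOL-Combinatorics.Permutations"
begin

text \<open>
  Partitions, sequences, variables and matrix entries are indexed from 1, as in the usual
  notation: a partition is a function giving its \<open>j\<close>-th part for \<open>j \<ge> 1\<close>, padded with zeros.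
  Values at index 0 are never used.
\<close>

definition is_partition :: "(nat \<Rightarrow> nat) \<Rightarrow> bool" where
  "is_partition lam \<longleftrightarrow> (\<forall>i\<ge>1. lam (Suc i) \<le> lam i) \<and> finite {i. 1 \<le> i \<and> lam i \<noteq> 0}"

definition part_length :: "(nat \<Rightarrow> nat) \<Rightarrow> nat" where
  "part_length lam = card {i. 1 \<le> i \<and> lam i \<noteq> 0}"

definition conjugate_part :: "(nat \<Rightarrow> nat) \<Rightarrow> nat \<Rightarrow> nat" where
  "conjugate_part lam i = card {j. 1 \<le> j \<and> i \<le> lam j}"


subsection \<open>Border strips and cores\<close>

definition diagram :: "(nat \<Rightarrow> nat) \<Rightarrow> (nat \<times> nat) set" where
  "diagram lam = {(i, j). 1 \<le> i \<and> 1 \<le> j \<and> j \<le> lam i}"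

fun adjacent_cells :: "nat \<times> nat \<Rightarrow> nat \<times> nat \<Rightarrow> bool" where
  "adjacent_cells (i, j) (k, l) \<longleftrightarrow>
     (i = k \<and> (l = Suc j \<or> j = Suc l)) \<or> (j = l \<and> (k = Suc i \<or> i = Suc k))"

definition connected_cells :: "(nat \<times> nat) set \<Rightarrow> bool" where
  "connected_cells S \<longleftrightarrow>
     (\<forall>c\<in>S. \<forall>d\<in>S. (\<lambda>a b. a \<in> S \<and> b \<in> S \<and> adjacent_cells a b)\<^sup>*\<^sup>* c d)"

definition border_strip :: "(nat \<times> nat) set \<Rightarrow> bool" where
  "border_strip S \<longleftrightarrow> S \<noteq> {} \<and> connected_cells S \<and>
     \<not> (\<exists>i j. {(i, j), (Suc i, j), (i, Suc j), (Suc i, Suc j)} \<subseteq> S)"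

definition remove_border_strip :: "nat \<Rightarrow> (nat \<Rightarrow> nat) \<Rightarrow> (nat \<Rightarrow> nat) \<Rightarrow> bool" where
  "remove_border_strip t lam \<mu> \<longleftrightarrow> is_partition lam \<and> is_partition \<mu> \<and>
     diagram \<mu> \<subseteq> diagram lam \<and>
     border_strip (diagram lam - diagram \<mu>) \<and> card (diagram lam - diagram \<mu>) = t"

definition is_t_core :: "nat \<Rightarrow> (nat \<Rightarrow> nat) \<Rightarrow> bool" where
  "is_t_core t lam \<longleftrightarrow> is_partition lam \<and> \<not> (\<exists>\<mu>. remove_border_strip t lam \<mu>)"

definition t_core_of :: "nat \<Rightarrow> (nat \<Rightarrow> nat) \<Rightarrow> (nat \<Rightarrow> nat) \<Rightarrow> bool" where
  "t_core_of t lam \<kappa> \<longleftrightarrow> (remove_border_strip t)\<^sup>*\<^sup>* lam \<kappa> \<and> is_t_core t \<kappa>"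


subsection \<open>Frobenius coordinates and symplectic partitions\<close>

text \<open>The set below always contains 0, so the empty partition has rank 0.\<close>

definition frob_rank :: "(nat \<Rightarrow> nat) \<Rightarrow> nat" where
  "frob_rank \<rho> = Max {k. k \<le> \<rho> k}"

definition frob_arm :: "(nat \<Rightarrow> nat) \<Rightarrow> nat \<Rightarrow> int" where
  "frob_arm \<rho> i = int (\<rho> i) - int i"

definition frob_leg :: "(nat \<Rightarrow> nat) \<Rightarrow> nat \<Rightarrow> int" where
  "frob_leg \<rho> i = int (conjugate_part \<rho> i) - int i"

definition symplectic_partition :: "(nat \<Rightarrow> nat) \<Rightarrow> bool" where
  "symplectic_partition \<rho> \<longleftrightarrow> is_partition \<rho> \<and>
     (\<forall>i\<in>{1..frob_rank \<rho>}. frob_leg \<rho> i = frob_arm \<rho> i + 1)"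

definition symplectic_t_core :: "nat \<Rightarrow> (nat \<Rightarrow> nat) \<Rightarrow> bool" where
  "symplectic_t_core t \<rho> \<longleftrightarrow> symplectic_partition \<rho> \<and> is_t_core t \<rho>"


subsection \<open>Beta sets, quotients and the sorting permutation\<close>

definition beta :: "(nat \<Rightarrow> nat) \<Rightarrow> nat \<Rightarrow> nat \<Rightarrow> nat" where
  "beta lam m j = lam j + (m - j)"

definition residue_entries :: "nat \<Rightarrow> (nat \<Rightarrow> nat) \<Rightarrow> nat \<Rightarrow> nat \<Rightarrow> nat set" where
  "residue_entries t lam m i = {b \<in> beta lam m ` {1..m}. b mod t = i}"

text \<open>The entries of a beta set are distinct, so counting values is counting positions.\<close>

definition residue_count :: "nat \<Rightarrow> (nat \<Rightarrow> nat) \<Rightarrow> nat \<Rightarrow> nat \<Rightarrow> nat" where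
  "residue_count t lam m i = card (residue_entries t lam m i)"

definition reduced_beta :: "nat \<Rightarrow> (nat \<Rightarrow> nat) \<Rightarrow> nat \<Rightarrow> nat \<Rightarrow> nat \<Rightarrow> nat" where
  "reduced_beta t lam m i j =
     (rev (sorted_list_of_set (residue_entries t lam m i)) ! (j - 1)) div t"

text \<open>
  The reduced entries are strictly decreasing in \<open>j\<close>, hence the \<open>j\<close>-th is at least
  \<open>n\<^sub>i - j\<close> and the natural-number subtraction does not truncate.
\<close>

definition t_quotient :: "nat \<Rightarrow> (nat \<Rightarrow> nat) \<Rightarrow> nat \<Rightarrow> nat \<Rightarrow> nat \<Rightarrow> nat" where
  "t_quotient t lam m i j =
     (if 1 \<le> j \<and> j \<le> residue_count t lam m i
      then (reduced_beta t lam m i j + j) - residue_count t lam m i else 0)"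

definition residue_sorting_perm :: "nat \<Rightarrow> (nat \<Rightarrow> nat) \<Rightarrow> nat \<Rightarrow> (nat \<Rightarrow> nat) \<Rightarrow> bool" where
  "residue_sorting_perm t lam m \<sigma> \<longleftrightarrow> \<sigma> permutes {1..m} \<and>
     (\<forall>a\<in>{1..m}. \<forall>b\<in>{1..m}. a < b \<longrightarrow>
        beta lam m (\<sigma> a) mod t < beta lam m (\<sigma> b) mod t \<or>
        (beta lam m (\<sigma> a) mod t = beta lam m (\<sigma> b) mod t \<and>
         beta lam m (\<sigma> a) > beta lam m (\<sigma> b)))"


subsection \<open>Characters\<close>

text \<open>
  The characters are quotients of determinants, evaluated at a point of an arbitrary field.
  Taking the field to be a field of rational functions and the \<open>y\<^sub>i\<close> to be monomials in the
  indeterminates gives the formal characters.  Since division by zero yields 0, the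
  quotients are meaningful only where the denominators do not vanish.
\<close>

definition det_of :: "nat \<Rightarrow> (nat \<Rightarrow> nat \<Rightarrow> 'a::comm_ring_1) \<Rightarrow> 'a" where
  "det_of N a = det (mat N N (\<lambda>(i, j). a (i + 1) (j + 1)))"

definition schur_char :: "nat \<Rightarrow> (nat \<Rightarrow> int) \<Rightarrow> (nat \<Rightarrow> 'a::field) \<Rightarrow> 'a" where
  "schur_char N \<mu> y =
     det_of N (\<lambda>i j. y i powi (\<mu> j + int N - int j)) /
     det_of N (\<lambda>i j. y i powi (int N - int j))"

definition sp_denom :: "nat \<Rightarrow> (nat \<Rightarrow> 'a::field) \<Rightarrow> 'a" where
  "sp_denom N y =
     det_of N (\<lambda>i j. y i powi (int N - int j + 1) - y i powi (- (int N - int j + 1)))"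

definition sp_char :: "nat \<Rightarrow> (nat \<Rightarrow> int) \<Rightarrow> (nat \<Rightarrow> 'a::field) \<Rightarrow> 'a" where
  "sp_char N \<mu> y =
     det_of N (\<lambda>i j. y i powi (\<mu> j + int N - int j + 1)
                      - y i powi (- (\<mu> j + int N - int j + 1))) /
     sp_denom N y"

definition so_char :: "nat \<Rightarrow> (nat \<Rightarrow> int) \<Rightarrow> (nat \<Rightarrow> 'a::field) \<Rightarrow> 'a" where
  "so_char N \<mu> y =
     det_of N (\<lambda>i j. y i powi (\<mu> j + int N - int j + 1)
                      - y i powi (- (\<mu> j + int N - int j))) /
     det_of N (\<lambda>i j. y i powi (int N - int j + 1) - y i powi (- (int N - int j)))"

definition primitive_root_of_unity :: "nat \<Rightarrow> 'a::field \<Rightarrow> bool" where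
  "primitive_root_of_unity t \<omega> \<longleftrightarrow> \<omega> ^ t = 1 \<and> (\<forall>k. 0 < k \<and> k < t \<longrightarrow> \<omega> ^ k \<noteq> 1)"

text \<open>
  \<open>twisted_vars n \<omega> x\<close> lists \<open>X, \<omega>X, \<omega>\<^sup>2X, \<dots>\<close> and \<open>doubled_vars n t x\<close> lists the
  \<open>t\<close>-th powers of \<open>X\<close> followed by their inverses, where \<open>X = (x\<^sub>1, \<dots>, x\<^sub>n)\<close>.
\<close>

definition twisted_vars :: "nat \<Rightarrow> 'a::field \<Rightarrow> (nat \<Rightarrow> 'a) \<Rightarrow> nat \<Rightarrow> 'a" where
  "twisted_vars n \<omega> x k = \<omega> ^ ((k - 1) div n) * x ((k - 1) mod n + 1)"

definition doubled_vars :: "nat \<Rightarrow> nat \<Rightarrow> (nat \<Rightarrow> 'a::field) \<Rightarrow> nat \<Rightarrow> 'a" where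
  "doubled_vars n t x k = (if k \<le> n then x k ^ t else inverse (x (k - n) ^ t))"


subsection \<open>The data of the factorization\<close>

definition mu1 :: "nat \<Rightarrow> nat \<Rightarrow> (nat \<Rightarrow> nat) \<Rightarrow> nat \<Rightarrow> nat \<Rightarrow> int" where
  "mu1 t n lam i j =
     (let q = t_quotient t lam (t * n) in
      if j \<le> residue_count t lam (t * n) i
      then int (q (t - 2 - i) 1) + int (q i j)
      else int (q (t - 2 - i) 1) - int (q (t - 2 - i) (2 * n + 1 - j)))"

definition sign_exponent :: "nat \<Rightarrow> nat \<Rightarrow> (nat \<Rightarrow> nat) \<Rightarrow> nat \<Rightarrow> int" where
  "sign_exponent t n lam r =
     - (\<Sum>i = t div 2..t - 2. int ((residue_count t lam (t * n) i + 1) choose 2))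
     + (if even t then int (n * (n + 1) div 2 + n * r) else 0)"

end

theory Submission
  imports Defs
begin

text \<open>
  A matrix depending only on \<open>\<omega>\<close> factors out of the numerator of the symplectic character.  What
  remains is a sparse matrix in which the \<open>i\<close>-th block of rows meets only the columns whose beta
  numbers have residue \<open>i\<close> or \<open>t - 2 - i\<close> (and, for \<open>i = t - 1\<close>, only residue \<open>t - 1\<close>).  Hence its
  determinant vanishes unless \<open>n\<^sub>i + n\<^sub>t\<^sub>-\<^sub>2\<^sub>-\<^sub>i = 2n\<close> and \<open>n\<^sub>t\<^sub>-\<^sub>1 = n\<close>; otherwise it is, up to sign, a product of
  numerators of one symplectic, possibly one orthogonal, and several Schur characters.  The
  Weyl denominator is the numerator for the empty partition, so the same factorization applies
  to it and the denominators of the right-hand side are automatically non-zero.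

  The residue counts do not change when a border strip of size \<open>t\<close> is removed, and the beta set of
  a \<open>t\<close>-core is determined by them.  In terms of the set of all \<open>\<rho>\<^sub>i - i\<close>, being symplectic is a reflection
  symmetry about \<open>-1\<close>, which for a \<open>t\<close>-core is exactly the condition on the counts; the rank counts
  the non-negative elements of that set.
\<close>

subsection \<open>Determinants indexed by lists\<close>

text \<open>A column with beta number \<open>b\<close> carries \<open>y^(b+1)\<close> and
  \<open>y^-(b+1)\<close>, and the powers of omega in them depend on \<open>b + 1\<close> and
  \<open>-(b + 1)\<close> modulo \<open>t\<close>. Negation exchanges the classes of
  \<open>i + 1\<close> and \<open>(t - 2 - i) + 1\<close>. Its fixed classes are 0, which is residue
  \<open>t - 1\<close> and gives the symplectic block, and for even \<open>t\<close> also
  \<open>t / 2\<close>, which is residue \<open>t / 2 - 1\<close> and gives the orthogonal block.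
  The delicate point is the sign. Everything that depends only on \<open>t\<close>,
  \<open>n\<close>, omega and \<open>x\<close> is collected in factors \<open>F\<close> and
  \<open>K\<close>, the same for \<open>lam\<close> and for the empty partition. They cancel without
  being evaluated, and they are non-zero because \<open>sp_denom\<close> is. What has to be counted
  is the parity of the column swaps. The rank matters only through its parity: for balanced counts
  the pair \<open>i\<close>, \<open>t - 2 - i\<close> contributes \<open>|n_i - n|\<close> to it,
  which has the parity of \<open>n_(t-2-i) + n\<close>. In this way the swaps across the middle
  block become the term \<open>n r\<close>.\<close>

definition list_det :: "('r \<Rightarrow> 'c \<Rightarrow> 'a::idom) \<Rightarrow> 'r list \<Rightarrow> 'c list \<Rightarrow> 'a" where
  "list_det f rs cs = det (mat (length rs) (length cs) (\<lambda>(i, j). f (rs ! i) (cs ! j)))"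

lemma list_det_transpose: "list_det f rs cs = list_det (\<lambda>c r. f r c) cs rs"
proof (cases "length rs = length cs")
  case True
  let ?A = "mat (length rs) (length cs) (\<lambda>(i, j). f (rs ! i) (cs ! j))"
  have "transpose_mat ?A = mat (length cs) (length rs) (\<lambda>(i, j). f (rs ! j) (cs ! i))"
    by (rule eq_matI) auto
  moreover have "det (transpose_mat ?A) = det ?A"
    by (rule det_transpose[of _ "length cs"]) (use True in auto)
  ultimately show ?thesis
    by (simp add: list_det_def)
\<comment> \<open>A non-square matrix has \<open>det\<close> equal to 0 by definition, so both sides
  vanish.\<close>
qed (simp add: list_det_def det_def)

lemma list_det_swap:
  "list_det f rs (as @ b # a # bs) = - list_det f rs (as @ a # b # bs)"
proof (cases "length rs = length as + length bs + 2")
  case True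
  let ?n = "length rs" and ?k = "length as"
  let ?A = "mat ?n ?n (\<lambda>(i, j). f (rs ! i) ((as @ a # b # bs) ! j))"
  have "swapcols ?k (Suc ?k) ?A = mat ?n ?n (\<lambda>(i, j). f (rs ! i) ((as @ b # a # bs) ! j))"
    by (rule eq_matI) (use True in \<open>auto simp: nth_append nth_Cons' mat_swapcols_def\<close>)
  moreover have "det (swapcols ?k (Suc ?k) ?A) = - det ?A"
    by (rule det_swapcols[of _ ?n]) (use True in auto)
  ultimately show ?thesis
    using True by (simp add: list_det_def)
qed (simp add: list_det_def det_def)

section \<open>Reordering lists by adjacent swaps\<close>

text \<open>Only the parity of the first argument matters: it is that of the number of adjacent swaps.\<close>

inductive rearranges :: "nat \<Rightarrow> 'a list \<Rightarrow> 'a list \<Rightarrow> bool" where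
  same: "rearranges 0 xs xs"
| adjacent: "rearranges k xs (as @ a # b # bs) \<Longrightarrow> rearranges (Suc k) xs (as @ b # a # bs)"
| parity: "rearranges k xs ys \<Longrightarrow> even k = even l \<Longrightarrow> rearranges l xs ys"

lemma list_det_rearrange_cols:
  "rearranges k cs ds \<Longrightarrow> list_det f rs cs = (-1) ^ k * list_det f rs ds"
proof (induction rule: rearranges.induct)
  case (adjacent k xs as a b bs)
  then show ?case
    using list_det_swap[of f rs as b a bs] by simp
next
  case (parity k xs ys l)
  then show ?case
    by (simp add: minus_one_power_iff)
qed simp

lemma list_det_rearrange_rows:
  "rearranges k rs ss \<Longrightarrow> list_det f rs cs = (-1) ^ k * list_det f ss cs"
  using list_det_rearrange_cols[of k rs ss "\<lambda>c r. f r c" cs]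
  by (simp add: list_det_transpose[of f])

lemma rearranges_trans:
  assumes "rearranges k xs ys" "rearranges l ys zs"
  shows "rearranges (k + l) xs zs"
  using assms(2,1)
proof (induction arbitrary: k rule: rearranges.induct)
  case (adjacent l ys as a b bs)
  then show ?case
    using rearranges.adjacent by fastforce
next
  case (parity l ys zs l')
  then show ?case
    using rearranges.parity[of "k + l" xs zs "k + l'"] by simp
qed simp

lemma rearranges_context: "rearranges k xs ys \<Longrightarrow> rearranges k (us @ xs @ vs) (us @ ys @ vs)"
proof (induction rule: rearranges.induct)
  case (adjacent k xs as a b bs)
  then show ?case
    using rearranges.adjacent[of k "us @ xs @ vs" "us @ as" a b "bs @ vs"] by simp
qed (auto intro: rearranges.intros)

lemmas rearranges_prefix = rearranges_context[of _ _ _ _ "[]", simplified]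
lemmas rearranges_suffix = rearranges_context[of _ _ _ "[]", simplified]

lemma rearranges_parityI: "rearranges k xs ys \<Longrightarrow> even (k + l) \<Longrightarrow> rearranges l xs ys"
  by (erule rearranges.parity) auto

lemma rearranges_move: "rearranges (length ys) (x # ys) (ys @ [x])"
proof (induction ys rule: rev_induct)
  case (snoc y ys)
  then have "rearranges (length ys) (x # ys @ [y]) (ys @ [x] @ [y])"
    using rearranges_suffix[of "length ys" "x # ys" "ys @ [x]" "[y]"] by simp
  then show ?case
    using rearranges.adjacent[of "length ys" "x # ys @ [y]" ys x y "[]"] by simp
qed (auto intro: rearranges.same)

lemma rearranges_block_swap: "rearranges (length xs * length ys) (xs @ ys) (ys @ xs)"
proof (induction xs)
  case (Cons x xs)
  have "rearranges (length xs * length ys) (x # xs @ ys) (x # ys @ xs)"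
    using rearranges_prefix[OF Cons, of "[x]"] by simp
  moreover have "rearranges (length ys) (x # ys @ xs) (ys @ x # xs)"
    using rearranges_suffix[OF rearranges_move[of ys x], of xs] by simp
  ultimately show ?case
    using rearranges_trans by (fastforce simp: add.commute)
qed (auto intro: rearranges.same)

lemma rearranges_rev: "rearranges (length xs choose 2) xs (rev xs)"
proof (induction xs)
  case (Cons x xs)
  have "rearranges (length xs choose 2) (x # xs) (x # rev xs)"
    using rearranges_prefix[OF Cons, of "[x]"] by simp
  then have "rearranges ((length xs choose 2) + length xs) (x # xs) (rev xs @ [x])"
    using rearranges_move[of "rev xs" x] rearranges_trans by fastforce
  then show ?case
    by (simp add: numeral_2_eq_2 add.commute)
qed (simp add: binomial_eq_0 rearranges.same)

text \<open>The induction treats \<open>L h @ M @ L' h\<close> as the middle part for the outer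
  pairs. Since each pair has even total length, this middle has the parity of \<open>M\<close>, so
  only the crossings of \<open>M\<close> with the second members count.\<close>

lemma rearranges_pairs:
  assumes "\<And>i. i < h \<Longrightarrow> even (length (L i) + length (L' i))"
  shows "rearranges (length M * (\<Sum>i<h. length (L' i)))
     (concat (map L [0..<h]) @ M @ concat (map L' (rev [0..<h])))
     (concat (map (\<lambda>i. L i @ L' i) [0..<h]) @ M)"
  using assms
proof (induction h arbitrary: M)
  case 0
  then show ?case by (auto intro: rearranges.same)
next
  case (Suc h)
  let ?P = "concat (map (\<lambda>i. L i @ L' i) [0..<h])"
  have 1: "rearranges (length (L h @ M @ L' h) * (\<Sum>i<h. length (L' i)))
     (concat (map L [0..<Suc h]) @ M @ concat (map L' (rev [0..<Suc h])))
     (?P @ L h @ M @ L' h)"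
    using Suc.IH[of "L h @ M @ L' h"] Suc.prems by simp
  have 2: "rearranges (length M * length (L' h)) (?P @ L h @ M @ L' h) (?P @ L h @ L' h @ M)"
    using rearranges_prefix[OF rearranges_block_swap[of M "L' h"], of "?P @ L h"] by simp
  show ?case
    by (rule rearranges_parityI) (use rearranges_trans[OF 1 2] Suc.prems[of h] in \<open>auto simp: algebra_simps\<close>)
qed

text \<open>The head \<open>a h\<close> has to cross the \<open>h\<close> earlier blocks of length
  \<open>n\<close>; summing \<open>h * n\<close> gives the binomial coefficient.\<close>

lemma rearranges_interleave:
  "rearranges (n * (h choose 2))
     (map a [0..<h] @ concat (map L [0..<h])) (concat (map (\<lambda>i. a i # L i) [0..<h]))"
  if "\<And>i. i < h \<Longrightarrow> length (L i) = n"
  using that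
proof (induction h)
  case (Suc h)
  let ?c = "concat (map L [0..<h])"
  have len: "length ?c = h * n"
    using Suc.prems by (simp add: length_concat comp_def sum_list_distinct_conv_sum_set)
  have "rearranges (h * n) ([a h] @ ?c) (?c @ [a h])"
    using rearranges_block_swap[of "[a h]" ?c] len by simp
  then have 1: "rearranges (h * n) (map a [0..<h] @ [a h] @ ?c @ L h) (map a [0..<h] @ ?c @ [a h] @ L h)"
    using rearranges_context[of "h * n" "[a h] @ ?c" "?c @ [a h]" "map a [0..<h]" "L h"] by simp
  have 2: "rearranges (n * (h choose 2)) (map a [0..<h] @ ?c @ [a h] @ L h)
      (concat (map (\<lambda>i. a i # L i) [0..<h]) @ [a h] @ L h)"
    using rearranges_suffix[OF Suc.IH] Suc.prems by simp
  show ?case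
    using rearranges_trans[OF 1 2]
    by (simp add: numeral_2_eq_2 algebra_simps)
qed (simp add: binomial_eq_0 rearranges.same)

text \<open>
  Passing from \<open>n\<close> to \<open>n + 1\<close> puts \<open>t\<close> new entries in front; each of the \<open>t choose 2\<close> pairs of
  them is swapped once, and they are then moved across \<open>n * (t choose 2)\<close> old entries.
\<close>

lemma rearranges_residues:
  assumes "0 < t"
  shows "rearranges ((t choose 2) * (Suc n choose 2)) (rev [0..<t * n])
    (concat (map (\<lambda>i. rev (map (\<lambda>q. t * q + i) [0..<n])) [0..<t]))"
proof (induction n)
  case 0
  have "concat (map (\<lambda>i. rev (map (\<lambda>q. t * q + i) [0..<0])) [0..<t]) = []"
    by (subst concat_eq_Nil_conv) auto
  then show ?case by (simp only: binomial_eq_0) (simp add: binomial_eq_0 rearranges.same)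
next
  case (Suc n)
  let ?L = "\<lambda>i. rev (map (\<lambda>q. t * q + i) [0..<n])"
  have "[0..<t * Suc n] = [0..<t * n] @ [t * n..<t * n + t]"
    using upt_add_eq_append[of 0 "t * n" t] by (simp add: add.commute)
  moreover have "[t * n..<t * n + t] = map (\<lambda>i. t * n + i) [0..<t]"
    using map_add_upt[of "t * n" t] by (simp add: add.commute)
  ultimately have eq: "rev [0..<t * Suc n] = rev (map (\<lambda>i. t * n + i) [0..<t]) @ rev [0..<t * n]"
    by simp
  have 1: "rearranges (t choose 2) (rev [0..<t * Suc n])
      (map (\<lambda>i. t * n + i) [0..<t] @ rev [0..<t * n])"
    unfolding eq using rearranges_suffix[OF rearranges_rev[of "rev (map (\<lambda>i. t * n + i) [0..<t])"]]
    by simp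
  have 2: "rearranges ((t choose 2) * (Suc n choose 2)) (map (\<lambda>i. t * n + i) [0..<t] @ rev [0..<t * n])
     (map (\<lambda>i. t * n + i) [0..<t] @ concat (map ?L [0..<t]))"
    by (rule rearranges_prefix[OF Suc])
  have 3: "rearranges (n * (t choose 2)) (map (\<lambda>i. t * n + i) [0..<t] @ concat (map ?L [0..<t]))
     (concat (map (\<lambda>i. (t * n + i) # ?L i) [0..<t]))"
    using rearranges_interleave[of t ?L n "\<lambda>i. t * n + i"] by simp
  have "Suc (Suc n) choose 2 = Suc n + (Suc n choose 2)"
    by (simp add: numeral_2_eq_2)
  then show ?case
    using rearranges_trans[OF rearranges_trans[OF 1 2] 3] by (simp add: algebra_simps)
qed

section \<open>Block structure, scaling and vanishing of determinants\<close>

lemma list_det_block_diag: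
  assumes len: "length rs = length cs" "length rs' = length cs'"
    and 0: "\<And>r c. r \<in> set rs \<Longrightarrow> c \<in> set cs' \<Longrightarrow> f r c = 0"
      "\<And>r c. r \<in> set rs' \<Longrightarrow> c \<in> set cs \<Longrightarrow> f r c = 0"
  shows "list_det f (rs @ rs') (cs @ cs') = list_det f rs cs * list_det f rs' cs'"
proof -
  let ?n = "length rs" and ?m = "length rs'"
  let ?A = "mat ?n ?n (\<lambda>(i, j). f (rs ! i) (cs ! j))"
  let ?D = "mat ?m ?m (\<lambda>(i, j). f (rs' ! i) (cs' ! j))"
  have "mat (?n + ?m) (?n + ?m) (\<lambda>(i, j). f ((rs @ rs') ! i) ((cs @ cs') ! j))
      = four_block_mat ?A (0\<^sub>m ?n ?m) (0\<^sub>m ?m ?n) ?D"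
    by (rule eq_matI) (use len in \<open>auto simp: nth_append 0\<close>)
  moreover have "det (four_block_mat ?A (0\<^sub>m ?n ?m) (0\<^sub>m ?m ?n) ?D) = det ?A * det ?D"
    by (rule det_four_block_mat_upper_right_zero) auto
  ultimately show ?thesis
    using len by (simp add: list_det_def)
qed

lemma list_det_blocks:
  assumes "\<And>i. i < h \<Longrightarrow> length (R i) = length (C i)"
    and "\<And>i j r c. i < h \<Longrightarrow> j < h \<Longrightarrow> i \<noteq> j \<Longrightarrow> r \<in> set (R i) \<Longrightarrow> c \<in> set (C j) \<Longrightarrow> f r c = 0"
  shows "list_det f (concat (map R [0..<h])) (concat (map C [0..<h])) = (\<Prod>i<h. list_det f (R i) (C i))"
  using assms
proof (induction h)
  case 0
  then show ?case by (simp add: list_det_def)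
next
  case (Suc h)
  have len: "length (concat (map R [0..<h])) = length (concat (map C [0..<h]))"
    using Suc.prems(1) by (auto simp: length_concat comp_def intro!: arg_cong[of _ _ sum_list])
  have "list_det f (concat (map R [0..<h]) @ R h) (concat (map C [0..<h]) @ C h)
      = list_det f (concat (map R [0..<h])) (concat (map C [0..<h])) * list_det f (R h) (C h)"
  proof (rule list_det_block_diag[OF len])
    show "length (R h) = length (C h)" using Suc.prems(1) by simp
  next
    fix r c assume "r \<in> set (concat (map R [0..<h]))" "c \<in> set (C h)"
    then obtain i where "i < h" "r \<in> set (R i)" by auto
    then show "f r c = 0" using Suc.prems(2)[of i h r c] \<open>c \<in> set (C h)\<close> by simp
  next
    fix r c assume "r \<in> set (R h)" "c \<in> set (concat (map C [0..<h]))"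
    then obtain i where "i < h" "c \<in> set (C i)" by auto
    then show "f r c = 0" using Suc.prems(2)[of h i r c] \<open>r \<in> set (R h)\<close> by simp
  qed
  moreover have "list_det f (concat (map R [0..<h])) (concat (map C [0..<h])) = (\<Prod>i<h. list_det f (R i) (C i))"
  proof (rule Suc.IH)
    fix i j r c assume "i < h" "j < h" "i \<noteq> j" "r \<in> set (R i)" "c \<in> set (C j)"
    then show "f r c = 0" using Suc.prems(2)[of i j r c] by simp
  qed (use Suc.prems(1) in simp)
  ultimately show ?case by simp
qed

lemma det_scale:
  fixes a :: "nat \<Rightarrow> nat \<Rightarrow> 'a::comm_ring_1"
  shows "det (mat N N (\<lambda>(i, j). r i * c j * a i j))
    = (\<Prod>i<N. r i) * (\<Prod>j<N. c j) * det (mat N N (\<lambda>(i, j). a i j))"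
proof -
  have "(\<Prod>i = 0..<N. mat N N (\<lambda>(i, j). r i * c j * a i j) $$ (i, p i))
      = (\<Prod>i<N. r i) * (\<Prod>j<N. c j) * (\<Prod>i = 0..<N. mat N N (\<lambda>(i, j). a i j) $$ (i, p i))"
    if p: "p permutes {0..<N}" for p
  proof -
    have lt: "p i < N" if "i < N" for i
      using permutes_in_image[OF p, of i] that by simp
    have "(\<Prod>i = 0..<N. mat N N (\<lambda>(i, j). r i * c j * a i j) $$ (i, p i))
        = (\<Prod>i = 0..<N. r i * c (p i) * a i (p i))"
      by (rule prod.cong) (auto simp: lt)
    also have "\<dots> = (\<Prod>i = 0..<N. r i) * (\<Prod>i = 0..<N. c (p i)) * (\<Prod>i = 0..<N. a i (p i))"
      by (simp add: prod.distrib)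
    also have "(\<Prod>i = 0..<N. c (p i)) = (\<Prod>i = 0..<N. c i)"
      using prod.permute[OF p, of c] by (simp add: comp_def)
    also have "(\<Prod>i = 0..<N. a i (p i)) = (\<Prod>i = 0..<N. mat N N (\<lambda>(i, j). a i j) $$ (i, p i))"
      by (rule prod.cong) (auto simp: lt)
    finally show ?thesis by (simp add: lessThan_atLeast0)
  qed
  then show ?thesis
    by (subst (1 2) det_def'[where n = N]) (auto simp: sum_distrib_left mult_ac intro!: sum.cong)
qed

text \<open>A permutation whose Leibniz term avoids all the prescribed zeros would map
  \<open>S\<close> bijectively onto \<open>T\<close>, which their sizes forbid.\<close>

lemma det_zero_blocks:
  fixes A :: "'a::comm_ring_1 mat"
  assumes A: "A \<in> carrier_mat N N" and ST: "S \<subseteq> {0..<N}" "T \<subseteq> {0..<N}" and card: "card S \<noteq> card T"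
    and 0: "\<And>i j. i < N \<Longrightarrow> j < N \<Longrightarrow> (i \<in> S) \<noteq> (j \<in> T) \<Longrightarrow> A $$ (i, j) = 0"
  shows "det A = 0"
proof -
  have "(\<Prod>i = 0..<N. A $$ (i, p i)) = 0" if p: "p permutes {0..<N}" for p
  proof -
    have "\<exists>i<N. (i \<in> S) \<noteq> (p i \<in> T)"
    proof (rule ccontr)
      assume "\<not> ?thesis"
      then have iff: "i \<in> S \<longleftrightarrow> p i \<in> T" if "i < N" for i using that by blast
      have "p ` S = T"
      proof
        show "p ` S \<subseteq> T" using iff ST by auto
        show "T \<subseteq> p ` S"
        proof
          fix j assume j: "j \<in> T"
          then have "j \<in> p ` {0..<N}" using permutes_image[OF p] ST by auto
          then show "j \<in> p ` S" using iff j by auto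
        qed
      qed
      then show False
        using card card_image[OF inj_on_subset[OF permutes_inj[OF p]], of S] by simp
    qed
    then obtain i where i: "i < N" "(i \<in> S) \<noteq> (p i \<in> T)" by blast
    then have "A $$ (i, p i) = 0"
      using 0[of i "p i"] permutes_in_image[OF p, of i] by auto
    then show ?thesis using i by (intro prod_zero) auto
  qed
  then show ?thesis by (subst det_def'[OF A]) simp
qed

lemma list_det_permute_cols:
  assumes \<sigma>: "\<sigma> permutes {1..N}" and len: "length rs = N"
  shows "list_det f rs (map (g \<circ> \<sigma>) [1..<Suc N]) = of_int (sign \<sigma>) * list_det f rs (map g [1..<Suc N])"
proof -
  \<comment> \<open>Matrix indices start at 0 while \<open>\<sigma>\<close> acts on
    \<open>{1..N}\<close>, so \<open>\<sigma>\<close> is transported along the shift; conjugation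
    keeps its sign.\<close>
  define p where "p = map_permutation {1..N} (\<lambda>i. i - 1) \<sigma>"
  have bij: "bij_betw (\<lambda>i. i - 1) {1..N} {0..<N}"
    by (rule bij_betwI[where g = Suc]) auto
  have p: "p permutes {0..<N}"
    unfolding p_def by (rule map_permutation_permutes[OF bij \<sigma>])
  have sgn: "sign p = sign \<sigma>"
    unfolding p_def by (rule sign_map_permutation) (use \<sigma> bij in \<open>auto simp: bij_betw_def\<close>)
  have app: "Suc (p i) = \<sigma> (Suc i)" if "i < N" for i
  proof -
    have "p (Suc i - 1) = \<sigma> (Suc i) - 1"
      unfolding p_def using that bij map_permutation_apply[of "\<lambda>i. i - 1" "{1..N}" "Suc i" \<sigma>]
      by (auto simp: bij_betw_def)
    moreover have "\<sigma> (Suc i) \<in> {1..N}"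
      using permutes_in_image[OF \<sigma>, of "Suc i"] that by simp
    ultimately show ?thesis by simp
  qed
  let ?A = "mat N N (\<lambda>(i, j). f (rs ! j) (g (Suc i)))"
  have pN: "p i < N" if "i < N" for i using permutes_in_image[OF p, of i] that by simp
  have "list_det f rs (map (g \<circ> \<sigma>) [1..<Suc N]) = list_det (\<lambda>c r. f r c) (map (g \<circ> \<sigma>) [1..<Suc N]) rs"
    by (rule list_det_transpose)
  also have "\<dots> = det (mat N N (\<lambda>(i, j). ?A $$ (p i, j)))"
    unfolding list_det_def using len by (intro arg_cong[of _ _ det] eq_matI) (auto simp: app pN simp del: upt_Suc)
  also have "\<dots> = of_int (sign p) * det ?A"
    using det_permute_rows[OF _ p, of ?A] by simp
  also have "det ?A = list_det (\<lambda>c r. f r c) (map g [1..<Suc N]) rs"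
    unfolding list_det_def using len by (intro arg_cong[of _ _ det] eq_matI) (auto simp del: upt_Suc)
  also have "\<dots> = list_det f rs (map g [1..<Suc N])"
    by (rule list_det_transpose)
  finally show ?thesis by (simp only: sgn)
qed

subsection \<open>Partitions and beta sets\<close>

lemma partition_antimono: "is_partition lam \<Longrightarrow> 1 \<le> i \<Longrightarrow> i \<le> j \<Longrightarrow> lam j \<le> lam i"
  by (rule dec_induct[of i j "\<lambda>j. lam j \<le> lam i"]) (auto simp: is_partition_def intro: order_trans)

lemma down_closed_nat_set:
  fixes A :: "nat set"
  assumes "finite A" "\<And>x y. x \<in> A \<Longrightarrow> y < x \<Longrightarrow> y \<in> A"
  shows "A = {..<card A}"
proof (cases "A = {}")
  case False
  have "A = {..Max A}"
  proof
    show "A \<subseteq> {..Max A}" using assms(1) by auto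
    show "{..Max A} \<subseteq> A"
      using assms(2)[OF Max_in[OF assms(1) False]] Max_in[OF assms(1) False] by (auto simp: le_less)
  qed
  then show ?thesis
    by (metis card_atMost lessThan_Suc_atMost)
qed simp

lemma down_closed_pos_set:
  fixes A :: "nat set"
  assumes "finite A" "\<And>x. x \<in> A \<Longrightarrow> 1 \<le> x" "\<And>x y. x \<in> A \<Longrightarrow> 1 \<le> y \<Longrightarrow> y < x \<Longrightarrow> y \<in> A"
  shows "A = {1..card A}"
proof -
  define B where "B = (\<lambda>x. x - 1) ` A"
  have A: "A = Suc ` B"
    using assms(2) by (force simp: B_def image_image)
  have "B = {..<card B}"
  proof (rule down_closed_nat_set)
    show "finite B" using assms(1) by (simp add: B_def)
    fix x y assume "x \<in> B" "y < x"
    then have "Suc x \<in> A" using A by auto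
    then have "Suc y \<in> A" using assms(3)[of "Suc x" "Suc y"] \<open>y < x\<close> by simp
    then show "y \<in> B" using A by auto
  qed
  moreover have "card B = card A"
    using A by (simp add: card_image)
  ultimately have "A = Suc ` {..<card A}"
    using A by metis
  then show ?thesis
    using image_Suc_lessThan by metis
qed

lemma partition_zero:
  assumes "is_partition lam" "part_length lam \<le> m" "m < j"
  shows "lam j = 0"
proof (rule ccontr)
  assume "lam j \<noteq> 0"
  then have "{1..j} \<subseteq> {i. 1 \<le> i \<and> lam i \<noteq> 0}"
    using partition_antimono[OF assms(1), of _ j] by force
  then have "card {1..j} \<le> part_length lam"
    unfolding part_length_def using assms(1) by (intro card_mono) (auto simp: is_partition_def)
  then show False using assms by simp
qed

lemma beta_strict_decreasing:
  assumes "is_partition lam" "1 \<le> i" "i < j" "j \<le> m"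
  shows "beta lam m j < beta lam m i"
  using partition_antimono[OF assms(1,2), of j] assms by (simp add: beta_def)

lemma beta_inj_on: "is_partition lam \<Longrightarrow> inj_on (beta lam m) {1..m}"
  by (rule linorder_inj_onI) (metis beta_strict_decreasing atLeastAtMost_iff less_irrefl, auto)

lemma residue_count_positions:
  assumes "is_partition lam"
  shows "residue_count t lam m i = card {j \<in> {1..m}. beta lam m j mod t = i}"
proof -
  have "residue_entries t lam m i = beta lam m ` {j \<in> {1..m}. beta lam m j mod t = i}"
    by (auto simp: residue_entries_def)
  then show ?thesis
    unfolding residue_count_def
    by (simp only:, intro card_image inj_on_subset[OF beta_inj_on[OF assms, of m]]) auto
qed

subsection \<open>Border strips\<close>

lemma diagram_diff_eq_Sigma:
  assumes "1 \<le> p" "\<And>i. 1 \<le> i \<Longrightarrow> i < p \<or> q < i \<Longrightarrow> lam i = \<mu> i"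
  shows "diagram lam - diagram \<mu> = Sigma {p..q} (\<lambda>i. {\<mu> i<..lam i})"
proof -
  have "i \<in> {p..q}" if "1 \<le> i" "lam i \<noteq> \<mu> i" for i
    using assms(2)[of i] that by force
  then show ?thesis
    using assms(1) by (fastforce simp: diagram_def)
qed

lemma strip_telescope:
  fixes lam \<mu> :: "nat \<Rightarrow> nat"
  assumes "p \<le> q" "\<And>i. p \<le> i \<Longrightarrow> i < q \<Longrightarrow> lam (Suc i) = Suc (\<mu> i)"
    "\<And>i. p \<le> i \<Longrightarrow> i \<le> q \<Longrightarrow> \<mu> i \<le> lam i"
  shows "(\<Sum>i = p..q. lam i - \<mu> i) + \<mu> q = lam p + (q - p)"
  using assms
proof (induction q rule: dec_induct)
  case (step q)
  then have "(\<Sum>i = p..q. lam i - \<mu> i) + \<mu> q = lam p + (q - p)" by simp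
  moreover have "lam (Suc q) = Suc (\<mu> q)" "\<mu> (Suc q) \<le> lam (Suc q)"
    using step.prems(1)[of q] step.prems(2)[of "Suc q"] step.hyps by simp_all
  ultimately show ?case using step.hyps by simp
qed simp

text \<open>By telescoping, the size of the strip is the beta number of row \<open>p\<close> of
  \<open>lam\<close> minus that of row \<open>q\<close> of \<open>\<mu>\<close>. This is why
  removing a strip amounts to lowering one beta number by its size.\<close>

lemma card_strip:
  assumes "1 \<le> p" "p \<le> q" "\<And>i. 1 \<le> i \<Longrightarrow> i < p \<or> q < i \<Longrightarrow> lam i = \<mu> i"
    "\<And>i. p \<le> i \<Longrightarrow> i < q \<Longrightarrow> lam (Suc i) = Suc (\<mu> i)"
    "\<And>i. p \<le> i \<Longrightarrow> i \<le> q \<Longrightarrow> \<mu> i \<le> lam i"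
  shows "card (diagram lam - diagram \<mu>) + \<mu> q = lam p + (q - p)"
proof -
  have "card (diagram lam - diagram \<mu>) = (\<Sum>i = p..q. lam i - \<mu> i)"
    by (subst diagram_diff_eq_Sigma[OF assms(1,3)]) auto
  then show ?thesis
    using strip_telescope[of p q lam \<mu>] assms by simp
qed

text \<open>Here \<open>p\<close> and \<open>q\<close> are the first and the last row that change.
  Consecutive rows of the strip share exactly one column: at least one by connectedness, at most one
  because there is no 2 by 2 square.\<close>

lemma remove_border_strip_shape:
  assumes "remove_border_strip t lam \<mu>"
  obtains p q where "1 \<le> p" "p \<le> q" "lam q \<noteq> 0" "\<And>i. 1 \<le> i \<Longrightarrow> \<mu> i \<le> lam i"
    "\<And>i. 1 \<le> i \<Longrightarrow> i < p \<or> q < i \<Longrightarrow> lam i = \<mu> i"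
    "\<And>i. p \<le> i \<Longrightarrow> i < q \<Longrightarrow> lam (Suc i) = Suc (\<mu> i)"
    "t + \<mu> q = lam p + (q - p)"
proof -
  define D where "D = diagram lam - diagram \<mu>"
  from assms have lam: "is_partition lam" and mu: "is_partition \<mu>"
    and sub: "diagram \<mu> \<subseteq> diagram lam" and D: "border_strip D" "card D = t"
    by (auto simp: remove_border_strip_def D_def)
  have le: "\<mu> i \<le> lam i" if "1 \<le> i" for i
  proof (cases "\<mu> i = 0")
    case False
    then have "(i, \<mu> i) \<in> diagram \<mu>" using that by (auto simp: diagram_def)
    then show ?thesis using sub by (auto simp: diagram_def)
  qed simp
  have D_iff: "(i, j) \<in> D \<longleftrightarrow> 1 \<le> i \<and> \<mu> i < j \<and> j \<le> lam i" for i j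
    by (auto simp: D_def diagram_def)
  define R where "R = {i. 1 \<le> i \<and> \<mu> i < lam i}"
  have fin: "finite R"
    by (rule finite_subset[of _ "{i. 1 \<le> i \<and> lam i \<noteq> 0}"])
      (use lam in \<open>auto simp: R_def is_partition_def\<close>)
  have "R \<noteq> {}"
    using D(1) D_iff by (fastforce simp: border_strip_def R_def)
  define p q where "p = Min R" and "q = Max R"
  have pR: "p \<in> R" and qR: "q \<in> R"
    using fin \<open>R \<noteq> {}\<close> by (auto simp: p_def q_def)
  have pq: "p \<le> q" using fin pR by (auto simp: q_def)
  have out: "lam i = \<mu> i" if "1 \<le> i" "i < p \<or> q < i" for i
  proof -
    have "i \<notin> R" using that fin by (auto simp: p_def q_def dest: Min_le Max_ge)
    then show ?thesis using le[OF that(1)] that(1) by (auto simp: R_def)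
  qed
  have link: "lam (Suc i) = Suc (\<mu> i)" if i: "p \<le> i" "i < q" for i
  proof -
    have i1: "1 \<le> i" using pR i by (auto simp: R_def)
    have "\<mu> i < lam (Suc i)"
    proof (rule ccontr)
      assume neg: "\<not> \<mu> i < lam (Suc i)"
      have cells: "(p, lam p) \<in> D" "(q, lam q) \<in> D"
        using pR qR by (auto simp: D_iff R_def)
      then have "(\<lambda>a b. a \<in> D \<and> b \<in> D \<and> adjacent_cells a b)\<^sup>*\<^sup>* (p, lam p) (q, lam q)"
        using D(1) by (simp add: border_strip_def connected_cells_def)
      \<comment> \<open>A path in the strip that starts in row \<open>p\<close> cannot leave the
        rows up to \<open>i\<close>: a vertical step into row \<open>Suc i\<close> would use a
        column above \<open>\<mu> i\<close> but at most \<open>lam (Suc i)\<close>.\<close>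
      then have "fst (q, lam q) \<le> i"
      proof (induction rule: rtranclp_induct)
        case (step a b)
        obtain a1 a2 b1 b2 where ab: "a = (a1, a2)" "b = (b1, b2)" by fastforce
        show ?case
        proof (rule ccontr)
          assume "\<not> fst b \<le> i"
          then have "a1 = i" "b1 = Suc i" "a2 = b2"
            using step.IH step.hyps(2) by (auto simp: ab)
          then show False using step.hyps(2) neg by (auto simp: ab D_iff)
        qed
      qed (use i in simp)
      then show False using i by simp
    qed
    moreover have "lam (Suc i) \<le> Suc (\<mu> i)"
    proof (rule ccontr)
      assume neg: "\<not> lam (Suc i) \<le> Suc (\<mu> i)"
      have "\<mu> (Suc i) \<le> \<mu> i" "lam (Suc i) \<le> lam i"
        using lam mu i1 by (auto simp: is_partition_def)
      \<comment> \<open>Two shared columns would produce this square.\<close>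
      then have "{(i, Suc (\<mu> i)), (Suc i, Suc (\<mu> i)), (i, Suc (Suc (\<mu> i))), (Suc i, Suc (Suc (\<mu> i)))} \<subseteq> D"
        using neg i1 by (auto simp: D_iff)
      then show False using D(1) unfolding border_strip_def by blast
    qed
    ultimately show ?thesis by simp
  qed
  have p1: "1 \<le> p" using pR by (simp add: R_def)
  have "card D + \<mu> q = lam p + (q - p)"
    unfolding D_def by (rule card_strip[of p q lam \<mu>]) (use p1 pq out link le in auto)
  then show thesis
    using that[OF p1 pq _ le out link] qR D(2) by (auto simp: R_def)
qed

text \<open>Rows \<open>p\<close> to \<open>q - 1\<close> of \<open>\<mu>\<close> inherit the beta
  numbers of the rows below them in \<open>lam\<close>, and row \<open>q\<close> receives that of
  row \<open>p\<close> minus \<open>t\<close>. Hence one entry drops by \<open>t\<close> and all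
  residues survive.\<close>

lemma remove_border_strip_residue_count:
  assumes rb: "remove_border_strip t lam \<mu>" and zero: "\<And>j. m < j \<Longrightarrow> lam j = 0"
  shows "residue_count t \<mu> m i = residue_count t lam m i" "\<And>j. m < j \<Longrightarrow> \<mu> j = 0"
proof -
  have part: "is_partition lam" "is_partition \<mu>"
    using rb by (auto simp: remove_border_strip_def)
  obtain p q where pq: "1 \<le> p" "p \<le> q" "lam q \<noteq> 0" and le: "\<And>i. 1 \<le> i \<Longrightarrow> \<mu> i \<le> lam i"
    and out: "\<And>i. 1 \<le> i \<Longrightarrow> i < p \<or> q < i \<Longrightarrow> lam i = \<mu> i"
    and link: "\<And>i. p \<le> i \<Longrightarrow> i < q \<Longrightarrow> lam (Suc i) = Suc (\<mu> i)"
    and t: "t + \<mu> q = lam p + (q - p)"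
    using remove_border_strip_shape[OF rb] by metis
  show "\<mu> j = 0" if "m < j" for j
    using le[of j] zero[OF that] that by simp
  have qm: "q \<le> m" using zero pq(3) not_less by blast
  \<comment> \<open>\<open>f\<close> cycles \<open>p..q\<close>: it sends a position of
    \<open>\<mu>\<close> to the position of \<open>lam\<close> from which its beta number
    comes.\<close>
  define f where "f j = (if p \<le> j \<and> j < q then Suc j else if j = q then p else j)" for j
  have f_bij: "bij_betw f {1..m} {1..m}"
    by (rule bij_betwI[where g = "\<lambda>j. if p < j \<and> j \<le> q then j - 1 else if j = p then q else j"])
      (use pq qm in \<open>auto simp: f_def\<close>)
  have mod: "beta lam m (f j) mod t = beta \<mu> m j mod t" if j: "j \<in> {1..m}" for j
  proof -
    consider "p \<le> j" "j < q" | "j = q" | "j < p \<or> q < j" by linarith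
    then show ?thesis
    proof cases
      case 1
      then have "m - j = Suc (m - Suc j)" using qm by simp
      then have "beta lam m (f j) = beta \<mu> m j" using 1 link[of j] by (simp add: f_def beta_def)
      then show ?thesis by simp
    next
      case 2
      then have "beta lam m (f j) = t + beta \<mu> m j" using t pq qm by (simp add: f_def beta_def)
      then show ?thesis by simp
    next
      case 3
      then have "f j = j" using pq by (auto simp: f_def)
      then show ?thesis using 3 out[of j] j by (simp add: beta_def)
    qed
  qed
  have "bij_betw f {j \<in> {1..m}. beta \<mu> m j mod t = i} {j \<in> {1..m}. beta lam m j mod t = i}"
    unfolding bij_betw_def
  proof
    show "inj_on f {j \<in> {1..m}. beta \<mu> m j mod t = i}"
      using f_bij by (auto simp: bij_betw_def intro: inj_on_subset)
    have "{j \<in> f ` {1..m}. beta lam m j mod t = i} = f ` {j \<in> {1..m}. beta lam m (f j) mod t = i}"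
      by auto
    moreover have "f ` {1..m} = {1..m}" using f_bij by (simp add: bij_betw_def)
    ultimately have "{j \<in> {1..m}. beta lam m j mod t = i} = f ` {j \<in> {1..m}. beta lam m (f j) mod t = i}"
      by simp
    also have "{j \<in> {1..m}. beta lam m (f j) mod t = i} = {j \<in> {1..m}. beta \<mu> m j mod t = i}"
      using mod by (intro Collect_cong conj_cong) auto
    finally show "f ` {j \<in> {1..m}. beta \<mu> m j mod t = i} = {j \<in> {1..m}. beta lam m j mod t = i}" ..
  qed
  then show "residue_count t \<mu> m i = residue_count t lam m i"
    unfolding residue_count_positions[OF part(1)] residue_count_positions[OF part(2)]
    by (rule bij_betw_same_card)
qed

lemma remove_border_strips_residue_count:
  assumes "(remove_border_strip t)\<^sup>*\<^sup>* lam \<kappa>" "\<And>j. m < j \<Longrightarrow> lam j = 0"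
  shows "(\<forall>i. residue_count t \<kappa> m i = residue_count t lam m i) \<and> (\<forall>j>m. \<kappa> j = 0)"
  using assms(1)
proof (induction rule: rtranclp_induct)
  case base
  then show ?case using assms(2) by simp
next
  case (step \<mu> \<nu>)
  then show ?case
    using remove_border_strip_residue_count[of t \<mu> \<nu> m] by auto
qed

text \<open>Every cell is joined to the end of row \<open>p\<close>: go right to the end of its row,
  step up, which stays inside because that cell is \<open>(i, Suc (\<mu> i))\<close>, and
  repeat.\<close>

lemma connected_strip:
  assumes "p \<le> q" and ne: "\<And>i. p \<le> i \<Longrightarrow> i \<le> q \<Longrightarrow> \<mu> i < lam i"
    and link: "\<And>i. p \<le> i \<Longrightarrow> i < q \<Longrightarrow> lam (Suc i) = Suc (\<mu> i)"
  shows "connected_cells (Sigma {p..q} (\<lambda>i. {\<mu> i<..lam i::nat}))" (is "connected_cells ?D")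
proof -
  let ?r = "\<lambda>a b. a \<in> ?D \<and> b \<in> ?D \<and> adjacent_cells a b"
  have sym: "symp ?r" by (auto simp: symp_def)
  have row: "?r\<^sup>*\<^sup>* (i, j) (i, lam i)" if "i \<in> {p..q}" "\<mu> i < j" "j \<le> lam i" for i j
    using that(3,2)
  proof (induction j rule: inc_induct)
    case (step j)
    then have "?r (i, j) (i, Suc j)" using that(1) by auto
    moreover have "?r\<^sup>*\<^sup>* (i, Suc j) (i, lam i)" using step by simp
    ultimately show ?case by (rule converse_rtranclp_into_rtranclp)
  qed simp
  have ends: "?r\<^sup>*\<^sup>* (i, lam i) (p, lam p)" if "p \<le> i" "i \<le> q" for i
    using that
  proof (induction i rule: dec_induct)
    case (step i)
    have "?r (Suc i, lam (Suc i)) (i, lam (Suc i))"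
      using step link[of i] ne[of i] ne[of "Suc i"] by auto
    moreover have "?r\<^sup>*\<^sup>* (i, lam (Suc i)) (i, lam i)"
      by (rule row) (use step link[of i] ne[of i] in auto)
    moreover have "?r\<^sup>*\<^sup>* (i, lam i) (p, lam p)" using step by simp
    ultimately show ?case by (blast intro: converse_rtranclp_into_rtranclp[of ?r] rtranclp_trans)
  qed simp
  have all: "?r\<^sup>*\<^sup>* c (p, lam p)" if "c \<in> ?D" for c
  proof -
    obtain i j where c: "c = (i, j)" by fastforce
    have "?r\<^sup>*\<^sup>* (i, j) (i, lam i)" by (rule row) (use that c in auto)
    moreover have "?r\<^sup>*\<^sup>* (i, lam i) (p, lam p)" by (rule ends) (use that c in auto)
    ultimately show ?thesis unfolding c by (rule rtranclp_trans)
  qed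
  show ?thesis
    unfolding connected_cells_def
  proof (intro ballI)
    fix c d assume cd: "c \<in> ?D" "d \<in> ?D"
    show "?r\<^sup>*\<^sup>* c d"
      using all[OF cd(1)] sympD[OF symp_rtranclp[OF sym] all[OF cd(2)]] by (rule rtranclp_trans)
  qed
qed

text \<open>This is the converse passage: if \<open>b - t\<close> were free, replacing
  \<open>b\<close> by \<open>b - t\<close> and sorting again would give a smaller partition whose
  complement in \<open>\<kappa>\<close> is a border strip of size \<open>t\<close>.\<close>

lemma t_core_beta_closed:
  assumes core: "is_t_core t \<kappa>" and "0 < t" and zero: "\<And>j. m < j \<Longrightarrow> \<kappa> j = 0"
    and b: "b \<in> beta \<kappa> m ` {1..m}" "t \<le> b"
  shows "b - t \<in> beta \<kappa> m ` {1..m}"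
proof (rule ccontr)
  assume nin: "b - t \<notin> beta \<kappa> m ` {1..m}"
  define c where "c = b - t"
  have part: "is_partition \<kappa>" using core by (simp add: is_t_core_def)
  obtain p where p: "1 \<le> p" "p \<le> m" "b = beta \<kappa> m p" using b by auto
  \<comment> \<open>The slot that the lowered entry \<open>c\<close> takes after sorting: rows
    \<open>p + 1\<close> to \<open>q\<close> move up by one.\<close>
  define q where "q = Max {j \<in> {1..m}. c < beta \<kappa> m j}"
  have "p \<in> {j \<in> {1..m}. c < beta \<kappa> m j}" using p b \<open>0 < t\<close> by (auto simp: c_def)
  then have "q \<in> {j \<in> {1..m}. c < beta \<kappa> m j}" and pq: "p \<le> q"
    unfolding q_def by (intro Max_in Max_ge; auto)+
  then have q: "1 \<le> q" "q \<le> m" "c < beta \<kappa> m q" by auto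
  have c_low: "\<kappa> (Suc q) + (m - q) \<le> c"
  proof (cases "q = m")
    case True
    then show ?thesis using zero[of "Suc q"] by simp
  next
    case False
    then have Sq: "Suc q \<in> {1..m}" using q by simp
    have "Suc q \<notin> {j \<in> {1..m}. c < beta \<kappa> m j}"
    proof
      assume "Suc q \<in> {j \<in> {1..m}. c < beta \<kappa> m j}"
      then have "Suc q \<le> q" unfolding q_def by (intro Max_ge) auto
      then show False by simp
    qed
    moreover have "beta \<kappa> m (Suc q) \<noteq> c" using nin Sq unfolding c_def by (metis imageI)
    ultimately have "beta \<kappa> m (Suc q) < c" using Sq by simp
    then show ?thesis using False q by (simp add: beta_def)
  qed
  \<comment> \<open>Moving a beta number from row \<open>i + 1\<close> to row \<open>i\<close> costs
    1 in the part. The subtractions do not truncate, by \<open>pos\<close> and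
    \<open>c_low\<close>.\<close>
  define \<mu> where "\<mu> i = (if p \<le> i \<and> i < q then \<kappa> (Suc i) - 1 else if i = q then c - (m - q) else \<kappa> i)" for i
  have c_up: "c - (m - q) < \<kappa> q" using q c_low by (simp add: beta_def)
  have pos: "1 \<le> \<kappa> i" if "1 \<le> i" "i \<le> q" for i
    using partition_antimono[OF part that] c_up by simp
  have dec: "\<kappa> (Suc i) \<le> \<kappa> i" if "1 \<le> i" for i
    using part that by (simp add: is_partition_def)
  have less: "\<mu> i < \<kappa> i" if "p \<le> i" "i \<le> q" for i
  proof (cases "i = q")
    case False
    then show ?thesis using that p dec[of i] pos[of "Suc i"] by (simp add: \<mu>_def)
  qed (use c_up in \<open>simp add: \<mu>_def\<close>)
  have out: "\<kappa> i = \<mu> i" if "1 \<le> i" "i < p \<or> q < i" for i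
    using that pq by (auto simp: \<mu>_def)
  have link: "\<kappa> (Suc i) = Suc (\<mu> i)" if "p \<le> i" "i < q" for i
    using that p pos[of "Suc i"] by (simp add: \<mu>_def)
  have le: "\<mu> i \<le> \<kappa> i" if "1 \<le> i" for i
    using less[of i] out[OF that] by force
  have mu_part: "is_partition \<mu>"
    unfolding is_partition_def
  proof
    show "\<forall>i\<ge>1. \<mu> (Suc i) \<le> \<mu> i"
    proof (intro allI impI)
      fix i :: nat assume i: "1 \<le> i"
      consider "i < p \<or> q < i" | "p \<le> i" "i < q" | "i = q" by linarith
      then show "\<mu> (Suc i) \<le> \<mu> i"
      proof cases
        case 1
        then show ?thesis using out[OF i 1] le[of "Suc i"] dec[OF i] by simp
      next
        case 2
        then show ?thesis using link[OF 2] less[of "Suc i"] by simp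
      next
        case 3
        then show ?thesis using out[of "Suc q"] c_low by (simp add: \<mu>_def)
      qed
    qed
    show "finite {i. 1 \<le> i \<and> \<mu> i \<noteq> 0}"
    proof (rule finite_subset)
      show "{i. 1 \<le> i \<and> \<mu> i \<noteq> 0} \<subseteq> {i. 1 \<le> i \<and> \<kappa> i \<noteq> 0}" using le by force
    qed (use part in \<open>simp add: is_partition_def\<close>)
  qed
  have D: "diagram \<kappa> - diagram \<mu> = Sigma {p..q} (\<lambda>i. {\<mu> i<..\<kappa> i})"
    by (rule diagram_diff_eq_Sigma[OF p(1) out])
  have "card (diagram \<kappa> - diagram \<mu>) + \<mu> q = \<kappa> p + (q - p)"
    by (rule card_strip[of p q \<kappa> \<mu>]) (use p pq out link less in \<open>auto intro: less_imp_le\<close>)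
  moreover have "\<mu> q = c - (m - q)" by (simp add: \<mu>_def)
  moreover have "c + t = \<kappa> p + (m - p)" using b p by (simp add: c_def beta_def)
  ultimately have card: "card (diagram \<kappa> - diagram \<mu>) = t"
    using c_low pq q by simp
  have "border_strip (diagram \<kappa> - diagram \<mu>)"
    unfolding border_strip_def
  proof (intro conjI)
    show "diagram \<kappa> - diagram \<mu> \<noteq> {}" using card \<open>0 < t\<close> by (metis card.empty less_irrefl)
    show "connected_cells (diagram \<kappa> - diagram \<mu>)"
      unfolding D by (rule connected_strip[of p q \<mu> \<kappa>]) (use pq less link in auto)
    show "\<nexists>i j. {(i, j), (Suc i, j), (i, Suc j), (Suc i, Suc j)} \<subseteq> diagram \<kappa> - diagram \<mu>"
    proof
      assume "\<exists>i j. {(i, j), (Suc i, j), (i, Suc j), (Suc i, Suc j)} \<subseteq> diagram \<kappa> - diagram \<mu>"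
      then obtain i j where "p \<le> i" "i < q" "\<mu> i < j" "Suc j \<le> \<kappa> (Suc i)"
        unfolding D by auto
      then show False using link[of i] by simp
    qed
  qed
  moreover have "diagram \<mu> \<subseteq> diagram \<kappa>"
  proof
    fix x assume "x \<in> diagram \<mu>"
    then show "x \<in> diagram \<kappa>" using le by (force simp: diagram_def)
  qed
  ultimately have "remove_border_strip t \<kappa> \<mu>"
    using part mu_part card by (simp add: remove_border_strip_def)
  then show False using core by (auto simp: is_t_core_def)
qed

subsection \<open>Frobenius coordinates and Maya sets\<close>

text \<open>The Maya diagram: a beta set shifted by \<open>-m\<close> and continued through all the
  zero parts, hence independent of \<open>m\<close>.\<close>

definition maya :: "(nat \<Rightarrow> nat) \<Rightarrow> int set" where
  "maya \<rho> = {int (\<rho> i) - int i |i. 1 \<le> i}"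

lemma le_conjugate_iff:
  assumes "is_partition \<rho>" "1 \<le> i" "1 \<le> j"
  shows "i \<le> conjugate_part \<rho> j \<longleftrightarrow> j \<le> \<rho> i"
proof -
  let ?A = "{i. 1 \<le> i \<and> j \<le> \<rho> i}"
  have "?A = {1..card ?A}"
  proof (rule down_closed_pos_set)
    show "finite ?A"
      by (rule finite_subset[of _ "{i. 1 \<le> i \<and> \<rho> i \<noteq> 0}"])
        (use assms in \<open>auto simp: is_partition_def\<close>)
    show "y \<in> ?A" if "x \<in> ?A" "1 \<le> y" "y < x" for x y
      using partition_antimono[OF assms(1), of y x] that by auto
  qed auto
  then have "i \<in> ?A \<longleftrightarrow> i \<in> {1..card ?A}" by (rule arg_cong)
  then show ?thesis
    using assms(2) by (auto simp: conjugate_part_def)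
qed

lemma rank_set:
  assumes "is_partition \<rho>"
  shows "{k. 1 \<le> k \<and> k \<le> \<rho> k} = {1..frob_rank \<rho>}"
proof -
  let ?A = "{k. 1 \<le> k \<and> k \<le> \<rho> k}"
  have fin: "finite ?A"
    by (rule finite_subset[of _ "{i. 1 \<le> i \<and> \<rho> i \<noteq> 0}"])
      (use assms in \<open>auto simp: is_partition_def\<close>)
  have eq: "?A = {1..card ?A}"
  proof (rule down_closed_pos_set[OF fin])
    show "y \<in> ?A" if "x \<in> ?A" "1 \<le> y" "y < x" for x y
      using partition_antimono[OF assms, of y x] that by auto
  qed auto
  have "{k. k \<le> \<rho> k} = insert 0 ?A"
    by (auto simp: le_less Suc_le_eq)
  also have "\<dots> = {0..card ?A}"
    by (subst eq) auto
  finally have "frob_rank \<rho> = Max {0..card ?A}"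
    unfolding frob_rank_def by (rule arg_cong)
  also have "\<dots> = card ?A"
    by (rule Max_eqI) auto
  finally show ?thesis using eq by metis
qed

lemma le_rank_iff:
  assumes "is_partition \<rho>" "1 \<le> k"
  shows "k \<le> frob_rank \<rho> \<longleftrightarrow> k \<le> \<rho> k"
proof -
  have "k \<in> {k. 1 \<le> k \<and> k \<le> \<rho> k} \<longleftrightarrow> k \<in> {1..frob_rank \<rho>}"
    by (simp only: rank_set[OF assms(1)])
  then show ?thesis using assms(2) by simp
qed

text \<open>The classical complementarity: the numbers coming from the rows and those coming from
  the columns partition the integers, since they label the vertical and the horizontal steps of the
  boundary path.\<close>

lemma not_in_maya_iff:
  assumes "is_partition \<rho>"
  shows "z \<notin> maya \<rho> \<longleftrightarrow> (\<exists>j\<ge>1. z = int j - 1 - int (conjugate_part \<rho> j))"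
proof
  assume z: "z \<notin> maya \<rho>"
  let ?P = "\<lambda>i. 1 \<le> i \<and> int (\<rho> i) - int i < z"
  obtain m where m: "\<And>j. m < j \<Longrightarrow> \<rho> j = 0"
    using partition_zero[OF assms order_refl] by blast
  have "?P (m + 1 + nat (- z))"
    using m[of "m + 1 + nat (- z)"] by auto
  \<comment> \<open>The first row whose entry lies below \<open>z\<close>. Since \<open>z\<close> is
    skipped, column \<open>z + i\<close> ends exactly in row \<open>i - 1\<close>.\<close>
  define i where "i = (LEAST i. ?P i)"
  have i: "?P i" unfolding i_def by (rule LeastI) fact
  define j where "j = nat (z + int i)"
  have j: "1 \<le> j" "int j = z + int i" using i by (auto simp: j_def)
  have "conjugate_part \<rho> j = i - 1"
  proof (rule antisym)
    show "conjugate_part \<rho> j \<le> i - 1"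
      using le_conjugate_iff[OF assms _ j(1), of i] i j(2) by auto
    show "i - 1 \<le> conjugate_part \<rho> j"
    proof (cases "i = 1")
      case False
      then have i1: "1 \<le> i - 1" using i by linarith
      have "\<not> ?P (i - 1)" unfolding i_def by (rule not_less_Least) (use i1 i_def in simp)
      moreover have "int (\<rho> (i - 1)) - int (i - 1) \<noteq> z" using z i1 unfolding maya_def by blast
      ultimately have "z < int (\<rho> (i - 1)) - int (i - 1)" using i1 by auto
      then have "j \<le> \<rho> (i - 1)" using j(2) i by auto
      then show ?thesis using le_conjugate_iff[OF assms i1 j(1)] by simp
    qed simp
  qed
  then show "\<exists>j\<ge>1. z = int j - 1 - int (conjugate_part \<rho> j)"
    using j i by (intro exI[of _ j]) auto
next
  assume "\<exists>j\<ge>1. z = int j - 1 - int (conjugate_part \<rho> j)"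
  then obtain j where j: "1 \<le> j" "z = int j - 1 - int (conjugate_part \<rho> j)" by blast
  show "z \<notin> maya \<rho>"
  proof
    assume "z \<in> maya \<rho>"
    then obtain i where i: "1 \<le> i" "z = int (\<rho> i) - int i" by (auto simp: maya_def)
    show False using le_conjugate_iff[OF assms i(1) j(1)] i j by linarith
  qed
qed

lemma strict_decreasing_image_unique:
  fixes f g :: "nat \<Rightarrow> int"
  assumes "f ` {1..r} = g ` {1..r}"
    and f: "\<And>i j. 1 \<le> i \<Longrightarrow> i < j \<Longrightarrow> j \<le> r \<Longrightarrow> f j < f i"
    and g: "\<And>i j. 1 \<le> i \<Longrightarrow> i < j \<Longrightarrow> j \<le> r \<Longrightarrow> g j < g i"
    and "i \<in> {1..r}"
  shows "f i = g i"
proof -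
  have srt: "sorted_wrt (<) (map h (rev [1..<Suc r]))"
    if h: "\<And>i j. 1 \<le> i \<Longrightarrow> i < j \<Longrightarrow> j \<le> r \<Longrightarrow> h j < h i" for h :: "nat \<Rightarrow> int"
    unfolding sorted_wrt_map sorted_wrt_rev
    by (rule sorted_wrt_mono_rel[OF _ sorted_wrt_upt]) (use h in auto)
  have "map f (rev [1..<Suc r]) = map g (rev [1..<Suc r])"
    by (rule strict_sorted_equal)
      (use srt[of f] srt[of g] f g assms(1) in \<open>auto simp: atLeastLessThanSuc_atLeastAtMost simp del: upt_Suc\<close>)
  then show ?thesis using assms(4) by (auto simp: atLeastLessThanSuc_atLeastAtMost simp del: upt_Suc)
qed

text \<open>The non-negative elements of \<open>maya\<close> are the arms, and by
  \<open>not_in_maya_iff\<close> the missing negative numbers are \<open>-1 - leg\<close>. So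
  \<open>leg = arm + 1\<close> says that \<open>a\<close> is present exactly when
  \<open>-2 - a\<close> is missing. The fixed point \<open>-1\<close> is present because a missing
  \<open>-1\<close> would be a leg equal to 0.\<close>

lemma symplectic_iff_maya:
  assumes "is_partition \<rho>"
  shows "symplectic_partition \<rho> \<longleftrightarrow>
    -1 \<in> maya \<rho> \<and> (\<forall>a\<ge>0. a \<in> maya \<rho> \<longleftrightarrow> -2 - a \<notin> maya \<rho>)"
proof -
  define r where "r = frob_rank \<rho>"
  have rank: "k \<le> \<rho> k \<longleftrightarrow> k \<le> r" if "1 \<le> k" for k
    using le_rank_iff[OF assms that] by (simp add: r_def)
  have rank': "k \<le> conjugate_part \<rho> k \<longleftrightarrow> k \<le> r" if "1 \<le> k" for k
    using le_conjugate_iff[OF assms that that] rank[OF that] by simp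
  have sym: "symplectic_partition \<rho> \<longleftrightarrow> (\<forall>i\<in>{1..r}. conjugate_part \<rho> i = Suc (\<rho> i))"
    using assms unfolding symplectic_partition_def r_def frob_leg_def frob_arm_def by auto
  note nin = not_in_maya_iff[OF assms]
  show ?thesis
  proof
    assume "symplectic_partition \<rho>"
    then have S: "conjugate_part \<rho> i = Suc (\<rho> i)" if "1 \<le> i" "i \<le> r" for i
      using sym that by simp
    have "-1 \<in> maya \<rho>"
    proof (rule ccontr)
      assume "-1 \<notin> maya \<rho>"
      then obtain j where j: "1 \<le> j" "-1 = int j - 1 - int (conjugate_part \<rho> j)" using nin by blast
      then have "j \<le> r" using rank'[OF j(1)] by auto
      then show False using S[OF j(1)] rank[OF j(1)] j by simp
    qed
    moreover have "a \<in> maya \<rho> \<longleftrightarrow> -2 - a \<notin> maya \<rho>" if "0 \<le> a" for a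
    proof
      assume "a \<in> maya \<rho>"
      then obtain i where i: "1 \<le> i" "a = int (\<rho> i) - int i" by (auto simp: maya_def)
      then have "i \<le> r" using rank[OF i(1)] that by auto
      then show "-2 - a \<notin> maya \<rho>"
        unfolding nin using S[OF i(1)] i by (intro exI[of _ i]) auto
    next
      assume "-2 - a \<notin> maya \<rho>"
      then obtain j where j: "1 \<le> j" "-2 - a = int j - 1 - int (conjugate_part \<rho> j)" using nin by blast
      then have "j \<le> r" using rank'[OF j(1)] that by auto
      then have "a = int (\<rho> j) - int j" using S[OF j(1)] j by simp
      then show "a \<in> maya \<rho>" using j(1) by (auto simp: maya_def)
    qed
    ultimately show "-1 \<in> maya \<rho> \<and> (\<forall>a\<ge>0. a \<in> maya \<rho> \<longleftrightarrow> -2 - a \<notin> maya \<rho>)" by blast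
  next
    assume M: "-1 \<in> maya \<rho> \<and> (\<forall>a\<ge>0. a \<in> maya \<rho> \<longleftrightarrow> -2 - a \<notin> maya \<rho>)"
    \<comment> \<open>Arms plus 1 and legs. Both decrease strictly, so it suffices to compare their
      sets of values on \<open>{1..r}\<close>.\<close>
    define f g where "f i = int (\<rho> i) - int i + 1" and "g i = int (conjugate_part \<rho> i) - int i" for i
    have f_dec: "f j < f i" if "1 \<le> i" "i < j" for i j
      using partition_antimono[OF assms, of i j] that by (simp add: f_def)
    have g_dec: "g j < g i" if "1 \<le> i" "i < j" for i j
    proof -
      have "conjugate_part \<rho> j \<le> conjugate_part \<rho> i"
      proof (cases "conjugate_part \<rho> j = 0")
        case False
        then have "1 \<le> conjugate_part \<rho> j" by simp
        then show ?thesis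
          using le_conjugate_iff[OF assms, of "conjugate_part \<rho> j" j]
            le_conjugate_iff[OF assms, of "conjugate_part \<rho> j" i] that by simp
      qed simp
      then show ?thesis using that by (simp add: g_def)
    qed
    have sub: "f ` {1..r} \<subseteq> g ` {1..r}"
    proof
      fix y assume "y \<in> f ` {1..r}"
      then obtain i where i: "1 \<le> i" "i \<le> r" "y = f i" by auto
      have "0 \<le> int (\<rho> i) - int i" using rank[OF i(1)] i by auto
      moreover have "int (\<rho> i) - int i \<in> maya \<rho>" using i by (auto simp: maya_def)
      ultimately have "-2 - (int (\<rho> i) - int i) \<notin> maya \<rho>" using M by blast
      then obtain j where j: "1 \<le> j" "-2 - (int (\<rho> i) - int i) = int j - 1 - int (conjugate_part \<rho> j)"
        using nin by blast
      then have "j \<le> r" using rank'[OF j(1)] \<open>0 \<le> int (\<rho> i) - int i\<close> by auto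
      moreover have "y = g j" using i j by (simp add: f_def g_def)
      ultimately show "y \<in> g ` {1..r}" using j(1) by auto
    qed
    have inj: "inj_on h {1..r}" if "\<And>i j. 1 \<le> i \<Longrightarrow> i < j \<Longrightarrow> h j < h i" for h :: "nat \<Rightarrow> int"
      by (rule linorder_inj_onI) (use that in force)+
    have "inj_on f {1..r}" "inj_on g {1..r}"
      using inj[of f] inj[of g] f_dec g_dec by blast+
    \<comment> \<open>Both sets have \<open>r\<close> elements, so the inclusion already gives
      equality.\<close>
    then have "card (f ` {1..r}) = card (g ` {1..r})"
      by (simp add: card_image)
    then have "f ` {1..r} = g ` {1..r}"
      using sub by (intro card_subset_eq) auto
    then have "f i = g i" if "i \<in> {1..r}" for i
      using strict_decreasing_image_unique[of f r g i] f_dec g_dec that by blast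
    then show "symplectic_partition \<rho>"
      unfolding sym f_def g_def by force
  qed
qed

section \<open>Cores in terms of residue counts\<close>

lemma maya_shift_iff:
  assumes zero: "\<And>j. m < j \<Longrightarrow> \<kappa> j = 0"
  shows "int b - int m \<in> maya \<kappa> \<longleftrightarrow> b \<in> beta \<kappa> m ` {1..m}"
    and "z < - int m \<Longrightarrow> z \<in> maya \<kappa>"
proof -
  show "int b - int m \<in> maya \<kappa> \<longleftrightarrow> b \<in> beta \<kappa> m ` {1..m}"
  proof
    assume "int b - int m \<in> maya \<kappa>"
    then obtain i where i: "1 \<le> i" "int b - int m = int (\<kappa> i) - int i" by (auto simp: maya_def)
    moreover have "i \<le> m" using zero[of i] i by linarith
    ultimately have "b = beta \<kappa> m i" by (simp add: beta_def)
    then show "b \<in> beta \<kappa> m ` {1..m}" using i(1) \<open>i \<le> m\<close> by auto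
  next
    assume "b \<in> beta \<kappa> m ` {1..m}"
    then obtain i where "1 \<le> i" "i \<le> m" "b = beta \<kappa> m i" by auto
    then show "int b - int m \<in> maya \<kappa>"
      unfolding maya_def by (auto simp: beta_def of_nat_diff intro!: exI[of _ i])
  qed
  show "z \<in> maya \<kappa>" if "z < - int m"
    using zero[of "nat (- z)"] that unfolding maya_def by (auto intro!: exI[of _ "nat (- z)"])
qed

text \<open>On the abacus with \<open>t\<close> runners, a core has all beads pushed to the bottom:
  \<open>t_core_beta_closed\<close> makes the occupied levels of each runner an initial segment,
  whose length is the residue count.\<close>

lemma core_beta_iff:
  assumes core: "is_t_core t \<kappa>" and t: "0 < t" and zero: "\<And>j. m < j \<Longrightarrow> \<kappa> j = 0"
  shows "b \<in> beta \<kappa> m ` {1..m} \<longleftrightarrow> b div t < residue_count t \<kappa> m (b mod t)"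
proof -
  define i where "i = b mod t"
  have i: "i < t" using t by (simp add: i_def)
  let ?Q = "{q. t * q + i \<in> beta \<kappa> m ` {1..m}}"
  have inj: "inj (\<lambda>q. t * q + i)" using t by (auto simp: inj_on_def)
  have img: "(\<lambda>q. t * q + i) ` ?Q = residue_entries t \<kappa> m i"
  proof
    have "(t * q + i) mod t = i" for q using i by simp
    then show "(\<lambda>q. t * q + i) ` ?Q \<subseteq> residue_entries t \<kappa> m i"
      unfolding residue_entries_def by blast
    show "residue_entries t \<kappa> m i \<subseteq> (\<lambda>q. t * q + i) ` ?Q"
    proof
      fix c assume "c \<in> residue_entries t \<kappa> m i"
      then have "c \<in> beta \<kappa> m ` {1..m}" "c = t * (c div t) + i"
        by (auto simp: residue_entries_def)
      then show "c \<in> (\<lambda>q. t * q + i) ` ?Q" by (metis (mono_tags, lifting) imageI mem_Collect_eq)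
    qed
  qed
  have "finite ((\<lambda>q. t * q + i) ` ?Q)"
    unfolding img by (simp add: residue_entries_def)
  then have fin: "finite ?Q"
    by (rule finite_imageD) (use inj in \<open>auto intro: inj_on_subset\<close>)
  have step: "q \<in> ?Q" if "Suc q \<in> ?Q" for q
    using t_core_beta_closed[of t \<kappa> m "t * Suc q + i", OF core t zero] that by simp
  have "?Q = {..<card ?Q}"
  proof (rule down_closed_nat_set[OF fin])
    fix x y :: nat assume "x \<in> ?Q" "y < x"
    then show "y \<in> ?Q" by (induction x) (use step in \<open>auto simp: less_Suc_eq\<close>)
  qed
  moreover have "card ?Q = residue_count t \<kappa> m i"
    unfolding residue_count_def img[symmetric] by (rule card_image[symmetric, OF inj_on_subset[OF inj]]) simp
  moreover have "b \<in> beta \<kappa> m ` {1..m} \<longleftrightarrow> b div t \<in> ?Q"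
    by (simp add: i_def)
  ultimately have "b \<in> beta \<kappa> m ` {1..m} \<longleftrightarrow> b div t \<in> {..<residue_count t \<kappa> m i}"
    by (simp only:)
  then show ?thesis by (simp add: i_def)
qed

text \<open>The shift by \<open>t * n\<close> keeps residues and lowers levels by \<open>n\<close>;
  every level below \<open>-n\<close> is filled by zero parts.\<close>

lemma core_maya_iff:
  assumes core: "is_t_core t \<kappa>" and t: "0 < t" and zero: "\<And>j. t * n < j \<Longrightarrow> \<kappa> j = 0"
    and i: "i < t"
  shows "int t * q + int i \<in> maya \<kappa> \<longleftrightarrow> q < int (residue_count t \<kappa> (t * n) i) - int n"
proof (cases "0 \<le> q + int n")
  case True
  define b where "b = t * nat (q + int n) + i"
  have "int t * q + int i = int b - int (t * n)"
    using True by (simp add: b_def algebra_simps)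
  moreover have "b div t = nat (q + int n)" "b mod t = i"
    using i t by (auto simp: b_def)
  ultimately have "int t * q + int i \<in> maya \<kappa> \<longleftrightarrow> nat (q + int n) < residue_count t \<kappa> (t * n) i"
    using maya_shift_iff(1)[of "t * n" \<kappa> b, OF zero] core_beta_iff[of t \<kappa> "t * n" b, OF core t zero] by simp
  then show ?thesis using True by auto
next
  case False
  then have "int t * (q + int n) \<le> int t * (- 1)" using t by (intro mult_left_mono) auto
  then have "int t * q + int i < - int (t * n)" using i by (simp add: algebra_simps)
  then show ?thesis using maya_shift_iff(2)[of "t * n" \<kappa>, OF zero] False by auto
qed

text \<open>The reflection \<open>a\<close> to \<open>-2 - a\<close> sends level \<open>q\<close> of
  class \<open>i\<close> to level \<open>-1 - q\<close> of class \<open>t - 2 - i\<close>, and level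
  \<open>q\<close> of class \<open>t - 1\<close> to level \<open>-2 - q\<close> of the same class.
  The symmetry thus compares the thresholds of \<open>core_maya_iff\<close>.\<close>

lemma symplectic_core_iff:
  assumes core: "is_t_core t \<kappa>" and t: "2 \<le> t" and zero: "\<And>j. t * n < j \<Longrightarrow> \<kappa> j = 0"
  defines "N \<equiv> residue_count t \<kappa> (t * n)"
  shows "symplectic_t_core t \<kappa> \<longleftrightarrow> N (t - 1) = n \<and> (\<forall>i<t - 1. N i + N (t - 2 - i) = 2 * n)"
proof -
  have "is_partition \<kappa>" using core by (simp add: is_t_core_def)
  then have sym: "symplectic_t_core t \<kappa> \<longleftrightarrow>
    -1 \<in> maya \<kappa> \<and> (\<forall>a\<ge>0. a \<in> maya \<kappa> \<longleftrightarrow> -2 - a \<notin> maya \<kappa>)"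
    using core symplectic_iff_maya by (simp add: symplectic_t_core_def)
  have maya: "int t * q + int i \<in> maya \<kappa> \<longleftrightarrow> q < int (N i) - int n" if "i < t" for q i
    unfolding N_def using core_maya_iff[of t \<kappa> n i q, OF core _ zero that] t by simp
  have last: "int t * q + int t - 1 \<in> maya \<kappa> \<longleftrightarrow> q < int (N (t - 1)) - int n" for q
    using maya[of "t - 1" q] t by (simp add: of_nat_diff algebra_simps)
  have refl: "-2 - (int t * q + int i) \<in> maya \<kappa> \<longleftrightarrow> -1 - q < int (N (t - 2 - i)) - int n"
    if "i < t - 1" for q i
  proof -
    have "-2 - (int t * q + int i) = int t * (-1 - q) + int (t - 2 - i)"
      using that t by (simp add: of_nat_diff algebra_simps)
    then show ?thesis using maya[of "t - 2 - i" "-1 - q"] t by simp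
  qed
  show ?thesis
  proof
    assume S: "symplectic_t_core t \<kappa>"
    then have m1: "-1 \<in> maya \<kappa>" and M: "\<And>a. 0 \<le> a \<Longrightarrow> a \<in> maya \<kappa> \<longleftrightarrow> -2 - a \<notin> maya \<kappa>"
      using sym by blast+
    have M': "a \<in> maya \<kappa> \<longleftrightarrow> -2 - a \<notin> maya \<kappa>" if "a \<noteq> -1" for a
      using M[of a] M[of "-2 - a"] that by (cases "0 \<le> a") auto
    have "N i + N (t - 2 - i) = 2 * n" if i: "i < t - 1" for i
    proof -
      have ne: "int t * q + int i \<noteq> -1" for q
      proof
        assume "int t * q + int i = -1"
        then have "int (Suc i) = int t * (- q)" by simp
        then have "int t dvd int (Suc i)" by (metis dvd_triv_left)
        then show False using i zdvd_not_zless[of "int (Suc i)" "int t"] by linarith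
      qed
      have "q < int (N i) - int n \<longleftrightarrow> \<not> -1 - q < int (N (t - 2 - i)) - int n" for q
        using M'[OF ne[of q]] maya[of i q] refl[OF i, of q] i by simp
      \<comment> \<open>Testing at the two thresholds gives the two inequalities between
        \<open>N i - n\<close> and \<open>n - N (t - 2 - i)\<close>.\<close>
      from this[of "int (N i) - int n"] this[of "int n - int (N (t - 2 - i))"] show ?thesis
        by linarith
    qed
    moreover have "N (t - 1) = n"
    proof -
      have "-1 < int (N (t - 1)) - int n" using last[of "-1"] m1 by simp
      \<comment> \<open>Otherwise \<open>t - 1\<close> and its mirror image \<open>-t - 1\<close>
        would both be present.\<close>
      moreover have "\<not> 0 < int (N (t - 1)) - int n"
      proof
        assume "0 < int (N (t - 1)) - int n"
        then have "int t * 0 + int t - 1 \<in> maya \<kappa>" "int t * (-2) + int t - 1 \<in> maya \<kappa>"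
          using last[of 0] last[of "-2"] by simp_all
        moreover have "-2 - (int t * 0 + int t - 1) = int t * (-2) + int t - 1" by simp
        moreover have "0 \<le> int t * 0 + int t - 1" using t by simp
        ultimately show False using M[of "int t * 0 + int t - 1"] by metis
      qed
      ultimately show ?thesis by simp
    qed
    ultimately show "N (t - 1) = n \<and> (\<forall>i<t - 1. N i + N (t - 2 - i) = 2 * n)" by blast
  next
    assume A: "N (t - 1) = n \<and> (\<forall>i<t - 1. N i + N (t - 2 - i) = 2 * n)"
    have "a \<in> maya \<kappa> \<longleftrightarrow> -2 - a \<notin> maya \<kappa>" if "0 \<le> a" for a
    proof -
      define q i where "q = a div int t" and "i = nat (a mod int t)"
      have it: "i < t" and a: "a = int t * q + int i" and "0 \<le> q"
        using t that by (auto simp: q_def i_def nat_less_iff pos_imp_zdiv_nonneg_iff)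
      show ?thesis
      proof (cases "i = t - 1")
        case True
        then have a': "a = int t * q + int t - 1" using a t by (simp add: of_nat_diff)
        have "-2 - a = int t * (-2 - q) + int t - 1" unfolding a' by (simp add: algebra_simps)
        then have "-2 - a \<in> maya \<kappa>" using last[of "-2 - q"] A \<open>0 \<le> q\<close> by presburger
        moreover have "a \<notin> maya \<kappa>" using last[of q] A \<open>0 \<le> q\<close> a' by simp
        ultimately show ?thesis by simp
      next
        case False
        then have i: "i < t - 1" using it by simp
        then have "N i + N (t - 2 - i) = 2 * n" using A by blast
        then show ?thesis
          unfolding a using maya[OF it, of q] refl[OF i, of q] by auto
      qed
    qed
    moreover have "-1 \<in> maya \<kappa>" using last[of "-1"] A by simp
    ultimately show "symplectic_t_core t \<kappa>" using sym by blast
  qed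
qed

text \<open>\<open>maya\<close> has \<open>frob_rank\<close> many non-negative elements. Class
  \<open>i\<close> contributes the levels from 0 up to its threshold, and the truncated subtraction
  gives 0 when the threshold is not positive.\<close>

lemma core_rank:
  assumes core: "is_t_core t \<kappa>" and t: "2 \<le> t" and zero: "\<And>j. t * n < j \<Longrightarrow> \<kappa> j = 0"
  shows "frob_rank \<kappa> = (\<Sum>i<t. residue_count t \<kappa> (t * n) i - n)"
proof -
  let ?e = "\<lambda>i. residue_count t \<kappa> (t * n) i - n"
  have part: "is_partition \<kappa>" using core by (simp add: is_t_core_def)
  define f where "f k = \<kappa> k - k" for k
  have inj: "inj_on f {1..frob_rank \<kappa>}"
  proof (rule linorder_inj_onI)
    fix i j assume ij: "i < j" "i \<in> {1..frob_rank \<kappa>}" "j \<in> {1..frob_rank \<kappa>}"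
    then have "i \<le> \<kappa> i" "j \<le> \<kappa> j" "1 \<le> i" using le_rank_iff[OF part, of i] le_rank_iff[OF part, of j] by simp_all
    then show "f i \<noteq> f j" using partition_antimono[OF part, of i j] ij by (simp add: f_def)
  qed auto
  have "f ` {1..frob_rank \<kappa>} = {a. int a \<in> maya \<kappa>}"
  proof
    show "f ` {1..frob_rank \<kappa>} \<subseteq> {a. int a \<in> maya \<kappa>}"
      unfolding rank_set[OF part, symmetric] by (auto simp: f_def maya_def of_nat_diff)
    show "{a. int a \<in> maya \<kappa>} \<subseteq> f ` {1..frob_rank \<kappa>}"
    proof
      fix a assume "a \<in> {a. int a \<in> maya \<kappa>}"
      then obtain i where i: "1 \<le> i" "int a = int (\<kappa> i) - int i" by (auto simp: maya_def)
      then have "i \<le> frob_rank \<kappa>" "a = f i"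
        using le_rank_iff[OF part i(1)] by (simp_all add: f_def)
      then show "a \<in> f ` {1..frob_rank \<kappa>}" using i(1) by simp
    qed
  qed
  also have "{a. int a \<in> maya \<kappa>} = (\<lambda>(i, q). t * q + i) ` (Sigma {..<t} (\<lambda>i. {..<?e i}))"
  proof (intro Set.set_eqI iffI)
    fix a assume "a \<in> {a. int a \<in> maya \<kappa>}"
    moreover have "int a = int t * int (a div t) + int (a mod t)"
      by (simp flip: of_nat_mult of_nat_add)
    ultimately have "a div t < ?e (a mod t)"
      using core_maya_iff[of t \<kappa> n "a mod t" "int (a div t)", OF core _ zero] t by auto
    then have "(a mod t, a div t) \<in> Sigma {..<t} (\<lambda>i. {..<?e i})" using t by simp
    moreover have "a = (\<lambda>(i, q). t * q + i) (a mod t, a div t)" by simp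
    ultimately show "a \<in> (\<lambda>(i, q). t * q + i) ` (Sigma {..<t} (\<lambda>i. {..<?e i}))" by blast
  next
    fix a assume "a \<in> (\<lambda>(i, q). t * q + i) ` (Sigma {..<t} (\<lambda>i. {..<?e i}))"
    then obtain i q where "i < t" "q < ?e i" "a = t * q + i" by auto
    then show "a \<in> {a. int a \<in> maya \<kappa>}"
      using core_maya_iff[of t \<kappa> n i "int q", OF core _ zero] t by auto
  qed
  finally have "card (f ` {1..frob_rank \<kappa>}) = card ((\<lambda>(i, q). t * q + i) ` (Sigma {..<t} (\<lambda>i. {..<?e i})))"
    by simp
  moreover have "inj_on (\<lambda>(i, q). t * q + i) (Sigma {..<t} (\<lambda>i. {..<?e i}))"
  proof (rule inj_onI)
    fix x y assume *: "x \<in> Sigma {..<t} (\<lambda>i. {..<?e i})" "y \<in> Sigma {..<t} (\<lambda>i. {..<?e i})"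
      "(\<lambda>(i, q). t * q + i) x = (\<lambda>(i, q). t * q + i) y"
    obtain i q j r where xy: "x = (i, q)" "y = (j, r)" by fastforce
    have "(t * q + i) mod t = (t * r + j) mod t" "(t * q + i) div t = (t * r + j) div t"
      using * xy by simp_all
    then show "x = y" using * xy by simp
  qed
  ultimately show ?thesis
    using inj by (simp add: card_image)
qed

text \<open>With \<open>t - 1 = 2 * h + c\<close> the partner of \<open>i\<close> is
  \<open>t - 2 - i\<close>; the middle range holds the self-paired class, if any.\<close>

lemma sum_fold_pairs:
  fixes e :: "nat \<Rightarrow> nat"
  shows "(\<Sum>i<2 * h + c. e i) = (\<Sum>i<h. e i + e (2 * h + c - Suc i)) + (\<Sum>i = h..<h + c. e i)"
proof -
  have "(\<Sum>i<2 * h + c. e i) = (\<Sum>i<h. e i) + (\<Sum>i = h..<h + c. e i) + (\<Sum>i = h + c..<2 * h + c. e i)"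
    by (simp add: lessThan_atLeast0 sum.atLeastLessThan_concat)
  also have "(\<Sum>i = h + c..<2 * h + c. e i) = (\<Sum>i<h. e (h + c + i))"
    using sum.shift_bounds_nat_ivl[of e 0 "h + c" h] by (simp add: lessThan_atLeast0 mult_2 add_ac)
  also have "\<dots> = (\<Sum>i<h. e (h + c + (h - Suc i)))"
    by (rule sum.nat_diff_reindex[symmetric])
  also have "\<dots> = (\<Sum>i<h. e (2 * h + c - Suc i))"
    by (rule sum.cong) (auto intro!: arg_cong[of _ _ e])
  finally show ?thesis by (simp add: sum.distrib)
qed

text \<open>In a pair the two truncated differences add up to \<open>|N (t - 2 - i) - n|\<close>,
  which is congruent to \<open>N (t - 2 - i) + n\<close> modulo 2. This replaces the rank in the
  sign by residue counts.\<close>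

lemma symplectic_core_rank_parity:
  assumes core: "is_t_core t \<kappa>" and t: "2 \<le> t" and zero: "\<And>j. t * n < j \<Longrightarrow> \<kappa> j = 0"
  defines "N \<equiv> residue_count t \<kappa> (t * n)"
  assumes sym: "symplectic_t_core t \<kappa>"
  shows "even (frob_rank \<kappa> + (\<Sum>i<(t - 1) div 2. N (t - 2 - i) + n))"
proof -
  define h where "h = (t - 1) div 2"
  define c where "c = (if even t then 1 else 0 :: nat)"
  have t_eq: "t - 1 = 2 * h + c" using t by (auto simp: h_def c_def elim!: evenE oddE)
  have N: "N (t - 1) = n" "\<And>i. i < t - 1 \<Longrightarrow> N i + N (t - 2 - i) = 2 * n"
    using symplectic_core_iff[of t \<kappa> n, OF core t zero] sym by (auto simp: N_def)
  have idx: "t - 2 - i = 2 * h + c - Suc i" for i using t_eq by simp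
  have "frob_rank \<kappa> = (\<Sum>i<t. N i - n)"
    unfolding N_def by (rule core_rank[of t \<kappa> n, OF core t zero])
  also have "\<dots> = (\<Sum>i<t - 1. N i - n)"
    using t N(1) sum.lessThan_Suc[of "\<lambda>i. N i - n" "t - 1"] by simp
  also have "\<dots> = (\<Sum>i<h. (N i - n) + (N (t - 2 - i) - n)) + (\<Sum>i = h..<h + c. N i - n)"
    unfolding t_eq idx by (rule sum_fold_pairs)
  also have "(\<Sum>i = h..<h + c. N i - n) = 0"
  proof (rule sum.neutral, rule ballI)
    fix i assume "i \<in> {h..<h + c}"
    then have "c = 1" "i = h" by (auto simp: c_def split: if_splits)
    then show "N i - n = 0" using N(2)[of h] t_eq idx[of h] by simp
  qed
  finally have "frob_rank \<kappa> + (\<Sum>i<h. N (t - 2 - i) + n)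
      = (\<Sum>i<h. (N i - n) + (N (t - 2 - i) - n) + (N (t - 2 - i) + n))"
    by (simp add: sum.distrib)
  moreover have "even ((N i - n) + (N (t - 2 - i) - n) + (N (t - 2 - i) + n))" if "i < h" for i
  proof -
    have N2: "N i + N (t - 2 - i) = 2 * n" using N(2)[of i] that t_eq by simp
    show ?thesis
    proof (cases "N i \<le> n")
      case True
      then have "(N i - n) + (N (t - 2 - i) - n) + (N (t - 2 - i) + n) = 2 * N (t - 2 - i)"
        using N2 by linarith
      then show ?thesis by (metis dvd_triv_left)
    next
      case False
      then have "(N i - n) + (N (t - 2 - i) - n) + (N (t - 2 - i) + n) = 2 * n"
        using N2 by linarith
      then show ?thesis by (metis dvd_triv_left)
    qed
  qed
  then have "even (\<Sum>i<h. (N i - n) + (N (t - 2 - i) - n) + (N (t - 2 - i) + n))"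
    by (intro dvd_sum) auto
  ultimately show ?thesis by (simp add: h_def)
qed

subsection \<open>Reduction to a sparse matrix\<close>

text \<open>
  Writing \<open>\<omega>\<^sup>a\<^sup>b y - \<omega>\<^sup>-\<^sup>a\<^sup>b z\<close> as a combination of \<open>\<omega>\<^sup>a\<^sup>c\<close>, \<open>0 < c \<le> t\<close>, factors a fixed matrix in \<open>\<omega>\<close> out of
  the numerator of the symplectic character.  Row \<open>(i, k)\<close> of the remaining matrix belongs to
  \<open>c = i + 1\<close> and to the variable \<open>x\<^sub>k\<close>; columns are indexed by entries of the beta set.
\<close>

definition twist_entry :: "nat \<Rightarrow> (nat \<Rightarrow> 'a::field) \<Rightarrow> nat \<times> nat \<Rightarrow> nat \<Rightarrow> 'a" where
  "twist_entry t x = (\<lambda>(i, k) b.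
     (if b mod t = i then x k powi (int b + 1) else 0) -
     (if (b + i + 2) mod t = 0 then x k powi (- (int b + 1)) else 0))"

definition block_row :: "nat \<Rightarrow> nat \<Rightarrow> (nat \<times> nat) list" where
  "block_row n i = map (\<lambda>k. (i, k)) [1..<Suc n]"

definition block_col :: "nat \<Rightarrow> (nat \<Rightarrow> nat) \<Rightarrow> nat \<Rightarrow> nat \<Rightarrow> nat list" where
  "block_col t lam m i = rev (sorted_list_of_set (residue_entries t lam m i))"

lemma concat_block_rows:
  assumes "0 < n"
  shows "concat (map (block_row n) [0..<t]) = map (\<lambda>p. (p div n, p mod n + 1)) [0..<t * n]"
proof (induction t)
  case (Suc t)
  have "[0..<Suc t * n] = [0..<t * n] @ map (\<lambda>k. t * n + k) [0..<n]"
    using upt_add_eq_append[of 0 "t * n" n] map_add_upt[of "t * n" n]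
    by (simp add: add.commute)
  moreover have "map (\<lambda>p. (p div n, p mod n + 1)) (map (\<lambda>k. t * n + k) [0..<n]) = block_row n t"
    unfolding block_row_def by (rule nth_equalityI) (use assms in \<open>auto simp del: upt_Suc\<close>)
  ultimately show ?case using Suc by simp
qed simp

lemma det_of_cong:
  assumes "\<And>i j. 1 \<le> i \<Longrightarrow> i \<le> N \<Longrightarrow> 1 \<le> j \<Longrightarrow> j \<le> N \<Longrightarrow> a i j = b i j"
  shows "det_of N a = det_of N b"
  unfolding det_of_def by (intro arg_cong[of _ _ det] eq_matI) (auto intro: assms)

text \<open>Only two terms survive, those with \<open>i + 1\<close> congruent to
  \<open>b + 1\<close> or to \<open>-(b + 1)\<close> modulo \<open>t\<close>; they may fall on the
  same \<open>i\<close>.\<close>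

lemma root_of_unity_twist_sum:
  fixes \<omega> :: "'a::field"
  assumes \<omega>: "\<omega> ^ t = 1" and t: "0 < t"
  shows "(\<Sum>i<t. \<omega> ^ (a * Suc i) * ((if b mod t = i then y else 0) - (if (b + i + 2) mod t = 0 then z else 0)))
    = \<omega> ^ (a * Suc b) * y - inverse (\<omega> ^ (a * Suc b)) * z"
proof -
  have pow: "\<omega> ^ (a * k) = 1" if "k mod t = 0" for k
  proof -
    from that obtain l where "k = t * l" by auto
    then have "\<omega> ^ (a * k) = (\<omega> ^ t) ^ (a * l)" by (simp add: power_mult[symmetric] mult_ac)
    then show ?thesis using \<omega> by simp
  qed
  have "\<omega> \<noteq> 0" using \<omega> t by (metis power_0_left zero_neq_one less_irrefl)
  \<comment> \<open>The unique index below \<open>t\<close> with \<open>i0 + 1\<close> congruent to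
    \<open>-(b + 1)\<close>.\<close>
  define i0 where "i0 = t - 1 - Suc b mod t"
  have i0: "i0 < t" using t by (simp add: i0_def)
  have key: "(b + i + 2) mod t = 0 \<longleftrightarrow> i = i0" if "i < t" for i
  proof -
    have m: "Suc b mod t < t" using t by simp
    have "(b + i + 2) mod t = (Suc b mod t + Suc i) mod t"
      by (metis add_Suc_right add_Suc_shift add_2_eq_Suc' mod_add_left_eq)
    also have "\<dots> = 0 \<longleftrightarrow> Suc b mod t + Suc i = t"
    proof
      assume "(Suc b mod t + Suc i) mod t = 0"
      then obtain l where l: "Suc b mod t + Suc i = t * l" by auto
      then have "0 < l" by (cases l) auto
      moreover have "t * l < t * 2" using l m that by linarith
      then have "l < 2" using t by simp
      ultimately have "l = 1" by simp
      then show "Suc b mod t + Suc i = t" using l by simp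
    qed simp
    also have "\<dots> \<longleftrightarrow> i = i0" using m that unfolding i0_def by linarith
    finally show ?thesis .
  qed
  have 1: "\<omega> ^ (a * Suc (b mod t)) = \<omega> ^ (a * Suc b)"
  proof -
    have "a * Suc b = a * Suc (b mod t) + a * (t * (b div t))"
      by (simp flip: distrib_left)
    then show ?thesis using pow[of "t * (b div t)"] by (simp add: power_add)
  qed
  have 2: "\<omega> ^ (a * Suc i0) = inverse (\<omega> ^ (a * Suc b))"
  proof -
    have "\<omega> ^ (a * Suc i0) * \<omega> ^ (a * Suc b) = \<omega> ^ (a * (b + i0 + 2))"
      by (simp add: power_add[symmetric] algebra_simps)
    also have "\<dots> = 1" using key[OF i0] by (intro pow) simp
    finally show ?thesis using \<open>\<omega> \<noteq> 0\<close> by (simp add: field_simps)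
  qed
  have "(\<Sum>i<t. \<omega> ^ (a * Suc i) * ((if b mod t = i then y else 0) - (if (b + i + 2) mod t = 0 then z else 0)))
    = (\<Sum>i<t. (if i = b mod t then \<omega> ^ (a * Suc i) * y else 0) - (if i = i0 then \<omega> ^ (a * Suc i) * z else 0))"
  proof (rule sum.cong[OF refl])
    fix i assume "i \<in> {..<t}"
    then have k: "(b + i + 2) mod t = 0 \<longleftrightarrow> i = i0" using key by simp
    show "\<omega> ^ (a * Suc i) * ((if b mod t = i then y else 0) - (if (b + i + 2) mod t = 0 then z else 0))
      = (if i = b mod t then \<omega> ^ (a * Suc i) * y else 0) - (if i = i0 then \<omega> ^ (a * Suc i) * z else 0)"
      unfolding k by (simp add: right_diff_distrib del: power_Suc mult_Suc_right)
  qed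
  also have "\<dots> = \<omega> ^ (a * Suc (b mod t)) * y - \<omega> ^ (a * Suc i0) * z"
    using t i0 by (simp add: sum_subtractf)
  finally show ?thesis unfolding 1 2 .
qed

text \<open>The factored matrix is the Kronecker product of the powers
  \<open>\<omega> ^ (a * Suc i)\<close> with the identity of size \<open>n\<close>. Its determinant
  does not depend on \<open>g\<close>, so numerator and denominator share it.\<close>

lemma twisted_det_factor:
  fixes \<omega> :: "'a::field"
  assumes \<omega>: "\<omega> ^ t = 1" and t: "0 < t" and n: "0 < n"
  obtains F where "\<And>g. det_of (t * n) (\<lambda>i j. twisted_vars n \<omega> x i powi (int (g j) + 1)
        - twisted_vars n \<omega> x i powi (- (int (g j) + 1)))
    = F * list_det (twist_entry t x) (concat (map (block_row n) [0..<t])) (map g [1..<Suc (t * n)])"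
proof -
  let ?N = "t * n"
  define A where "A g = mat ?N ?N (\<lambda>(p, j). twisted_vars n \<omega> x (p + 1) powi (int (g (j + 1)) + 1)
        - twisted_vars n \<omega> x (p + 1) powi (- (int (g (j + 1)) + 1)))" for g
  define B where "B g = mat ?N ?N (\<lambda>(p, j). twist_entry t x (p div n, p mod n + 1) (g (j + 1)))" for g
  define F where "F = mat ?N ?N (\<lambda>(p, p'). if p mod n = p' mod n then \<omega> ^ (p div n * Suc (p' div n)) else 0)"
  have "A g = F * B g" for g
  proof (rule eq_matI)
    fix p j assume "p < dim_row (F * B g)" "j < dim_col (F * B g)"
    then have p: "p < ?N" and j: "j < ?N" by (simp_all add: F_def B_def)
    define a k b where "a = p div n" and "k = p mod n" and "b = g (j + 1)"
    have k: "k < n" using n by (simp add: k_def)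
    have "(F * B g) $$ (p, j) = (\<Sum>p'<?N. F $$ (p, p') * B g $$ (p', j))"
      using p j by (simp add: F_def B_def scalar_prod_def lessThan_atLeast0)
    also have "\<dots> = (\<Sum>p'<?N. (if k = p' mod n then \<omega> ^ (a * Suc (p' div n)) else 0) *
        twist_entry t x (p' div n, p' mod n + 1) b)"
      by (rule sum.cong) (use p j in \<open>simp_all add: F_def B_def a_def k_def b_def\<close>)
    \<comment> \<open>Writing \<open>p' = i * n + l\<close>, only \<open>l = k\<close> contributes
      inside each block.\<close>
    also have "\<dots> = (\<Sum>i<t. \<Sum>p'\<in>{i * n..<i * n + n}. (if k = p' mod n then \<omega> ^ (a * Suc (p' div n)) else 0) *
        twist_entry t x (p' div n, p' mod n + 1) b)"
      by (rule sum.nat_group[symmetric])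
    also have "\<dots> = (\<Sum>i<t. \<omega> ^ (a * Suc i) * twist_entry t x (i, k + 1) b)"
    proof (rule sum.cong[OF refl])
      fix i assume "i \<in> {..<t}"
      let ?g = "\<lambda>p'. (if k = p' mod n then \<omega> ^ (a * Suc (p' div n)) else 0) *
          twist_entry t x (p' div n, p' mod n + 1) b"
      have "sum ?g {i * n..<i * n + n} = (\<Sum>l\<in>{0..<n}. ?g (l + i * n))"
        using sum.shift_bounds_nat_ivl[of ?g 0 "i * n" n] by (simp add: add.commute)
      also have "\<dots> = (\<Sum>l\<in>{0..<n}. if l = k then \<omega> ^ (a * Suc i) * twist_entry t x (i, k + 1) b else 0)"
      proof (rule sum.cong[OF refl])
        fix l assume "l \<in> {0..<n}"
        then have "(l + i * n) div n = i" "(l + i * n) mod n = l" by auto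
        then show "?g (l + i * n) = (if l = k then \<omega> ^ (a * Suc i) * twist_entry t x (i, k + 1) b else 0)"
          by (simp only:) auto
      qed
      also have "\<dots> = \<omega> ^ (a * Suc i) * twist_entry t x (i, k + 1) b"
        using k by simp
      finally show "(\<Sum>p'\<in>{i * n..<i * n + n}. (if k = p' mod n then \<omega> ^ (a * Suc (p' div n)) else 0) *
          twist_entry t x (p' div n, p' mod n + 1) b) = \<omega> ^ (a * Suc i) * twist_entry t x (i, k + 1) b" .
    qed
    also have "\<dots> = \<omega> ^ (a * Suc b) * x (k + 1) powi (int b + 1)
        - inverse (\<omega> ^ (a * Suc b)) * x (k + 1) powi (- (int b + 1))"
      unfolding twist_entry_def prod.case by (rule root_of_unity_twist_sum[OF \<omega> t])
    also have "\<omega> ^ (a * Suc b) = (\<omega> ^ a) powi (int b + 1)"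
      using power_int_of_nat[of "\<omega> ^ a" "Suc b"] by (simp add: power_mult add.commute del: power_Suc mult_Suc_right)
    also have "inverse ((\<omega> ^ a) powi (int b + 1)) = (\<omega> ^ a) powi (- (int b + 1))"
      by (rule power_int_minus[symmetric])
    also have "(\<omega> ^ a) powi (int b + 1) * x (k + 1) powi (int b + 1)
        - (\<omega> ^ a) powi (- (int b + 1)) * x (k + 1) powi (- (int b + 1)) = A g $$ (p, j)"
      using p j unfolding A_def by (simp add: twisted_vars_def power_int_mult_distrib a_def k_def b_def)
    finally show "A g $$ (p, j) = (F * B g) $$ (p, j)" ..
  qed (simp_all add: A_def F_def B_def)
  then have "det (A g) = det F * det (B g)" for g
    using det_mult[of F ?N "B g"] by (simp add: F_def B_def)
  moreover have "det (B g) = list_det (twist_entry t x) (concat (map (block_row n) [0..<t])) (map g [1..<Suc ?N])" for g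
    unfolding B_def list_det_def concat_block_rows[OF n]
    by (intro arg_cong[of _ _ det] eq_matI) (auto simp del: upt_Suc)
  ultimately show thesis
    using that[of "det F"] by (simp add: det_of_def A_def)
qed

text \<open>Since \<open>b + i + 2\<close> lies between 2 and \<open>2 * t\<close>, only these two
  multiples can occur, the larger one only for \<open>b = i = t - 1\<close>.\<close>

lemma partner_residue:
  assumes "b < t" "i < (t::nat)"
  shows "(b + i + 2) mod t = 0 \<longleftrightarrow> b + i + 2 = t \<or> b + i + 2 = 2 * t"
proof
  assume "(b + i + 2) mod t = 0"
  then obtain l where l: "b + i + 2 = t * l" by auto
  then have "0 < l" by (cases l) auto
  moreover have "t * l \<le> t * 2" using l assms by linarith
  then have "l \<le> 2" using assms by simp
  ultimately have "l = 1 \<or> l = 2" by linarith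
  then show "b + i + 2 = t \<or> b + i + 2 = 2 * t" using l by auto
qed auto

lemma twist_entry_zero:
  assumes "0 < t" "i < t" "b mod t \<noteq> i" "b mod t + i + 2 \<noteq> t" "b mod t + i + 2 \<noteq> 2 * t"
  shows "twist_entry t x (i, k) b = 0"
proof -
  have "(b + i + 2) mod t = (b mod t + i + 2) mod t"
    by (metis add.assoc mod_add_left_eq)
  then show ?thesis
    using partner_residue[of "b mod t" t i] assms by (simp add: twist_entry_def)
qed

lemma card_preimage_sum:
  assumes "finite A" "finite P"
  shows "card {j \<in> A. g j \<in> P} = (\<Sum>i\<in>P. card {j \<in> A. g j = i})"
proof -
  have "{j \<in> A. g j \<in> P} = (\<Union>i\<in>P. {j \<in> A. g j = i})" by auto
  then show ?thesis
    using assms by (simp only:) (intro card_UN_disjoint, auto)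
qed

text \<open>A violated count yields a set \<open>P\<close> of residues, closed under partnership,
  for which the \<open>n * card P\<close> rows do not match the number of columns. Rows of
  \<open>P\<close> meet only columns of \<open>P\<close> and conversely, so
  \<open>det_zero_blocks\<close> applies.\<close>

lemma twisted_det_zero:
  fixes x :: "nat \<Rightarrow> 'a::field"
  assumes part: "is_partition lam" and t: "2 \<le> t" and n: "0 < n"
  defines "N \<equiv> residue_count t lam (t * n)"
  assumes bad: "\<not> (N (t - 1) = n \<and> (\<forall>i<t - 1. N i + N (t - 2 - i) = 2 * n))"
  shows "list_det (twist_entry t x) (concat (map (block_row n) [0..<t])) (map (beta lam (t * n)) [1..<Suc (t * n)]) = 0"
proof -
  let ?M = "t * n"
  obtain P where P: "P \<subseteq> {..<t}" "n * card P \<noteq> (\<Sum>i\<in>P. N i)"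
    and closed: "\<And>b i. b < t \<Longrightarrow> i < t \<Longrightarrow> b + i + 2 = t \<or> b + i + 2 = 2 * t \<Longrightarrow> b \<in> P \<longleftrightarrow> i \<in> P"
  proof (cases "N (t - 1) = n")
    case False
    show thesis
      by (rule that[of "{t - 1}"]) (use t False in auto)
  next
    case True
    then obtain i where i: "i < t - 1" "N i + N (t - 2 - i) \<noteq> 2 * n" using bad by blast
    show thesis
    proof (rule that[of "{i, t - 2 - i}"])
      show "n * card {i, t - 2 - i} \<noteq> (\<Sum>i\<in>{i, t - 2 - i}. N i)"
        \<comment> \<open>If \<open>i\<close> is its own partner, the set is a singleton and the
          condition reads \<open>N i \<noteq> n\<close>.\<close>
        using i by (cases "i = t - 2 - i") auto
    qed (use i in auto)
  qed
  have finP: "finite P" using P(1) finite_subset by blast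
  define S where "S = {p \<in> {0..<?M}. p div n \<in> P}"
  define T where "T = {j \<in> {0..<?M}. beta lam ?M (Suc j) mod t \<in> P}"
  have "card S = (\<Sum>i\<in>P. card {p \<in> {0..<?M}. p div n = i})"
    unfolding S_def using finP by (intro card_preimage_sum) auto
  also have "\<dots> = (\<Sum>i\<in>P. n)"
  proof (rule sum.cong[OF refl])
    fix i assume "i \<in> P"
    then have "i < t" using P by auto
    then have le: "Suc i * n \<le> ?M" by (intro mult_le_mono1) simp
    have iff: "p div n = i \<longleftrightarrow> i * n \<le> p \<and> p < Suc i * n" for p
      using div_less_iff_less_mult[OF n, of p "Suc i"] less_eq_div_iff_mult_less_eq[OF n, of i p] by auto
    have "p \<in> {p \<in> {0..<?M}. p div n = i} \<longleftrightarrow> p \<in> {i * n..<i * n + n}" for p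
      unfolding mem_Collect_eq iff using le by simp linarith
    then have "{p \<in> {0..<?M}. p div n = i} = {i * n..<i * n + n}"
      by blast
    then show "card {p \<in> {0..<?M}. p div n = i} = n" by simp
  qed
  finally have S: "card S = n * card P" by simp
  have "card T = (\<Sum>i\<in>P. card {j \<in> {0..<?M}. beta lam ?M (Suc j) mod t = i})"
    unfolding T_def using finP by (intro card_preimage_sum) auto
  also have "\<dots> = (\<Sum>i\<in>P. N i)"
  proof (rule sum.cong[OF refl])
    fix i
    have "{j \<in> {1..?M}. beta lam ?M j mod t = i} = Suc ` {j \<in> {0..<?M}. beta lam ?M (Suc j) mod t = i}"
    proof
      show "{j \<in> {1..?M}. beta lam ?M j mod t = i} \<subseteq> Suc ` {j \<in> {0..<?M}. beta lam ?M (Suc j) mod t = i}"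
      proof
        fix j assume "j \<in> {j \<in> {1..?M}. beta lam ?M j mod t = i}"
        then show "j \<in> Suc ` {j \<in> {0..<?M}. beta lam ?M (Suc j) mod t = i}"
          by (intro image_eqI[of _ _ "j - 1"]) auto
      qed
    qed auto
    then show "card {j \<in> {0..<?M}. beta lam ?M (Suc j) mod t = i} = N i"
      unfolding N_def residue_count_positions[OF part] by (simp add: card_image)
  qed
  finally have T: "card T = (\<Sum>i\<in>P. N i)" .
  have rows: "concat (map (block_row n) [0..<t]) = map (\<lambda>p. (p div n, p mod n + 1)) [0..<?M]"
    by (rule concat_block_rows[OF n])
  show ?thesis
    unfolding list_det_def rows
  proof (rule det_zero_blocks[of _ ?M S T])
    show "card S \<noteq> card T" using S T P by simp
    fix p j assume pj: "p < ?M" "j < ?M" "(p \<in> S) \<noteq> (j \<in> T)"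
    have pt: "p div n < t" using pj(1) by (simp add: less_mult_imp_div_less)
    let ?b = "beta lam ?M (Suc j)"
    have bt: "?b mod t < t" using t by simp
    have ne: "(p div n \<in> P) \<noteq> (?b mod t \<in> P)" using pj by (auto simp: S_def T_def)
    have "twist_entry t x (p div n, p mod n + 1) ?b = 0"
      by (rule twist_entry_zero) (use closed[OF bt pt] ne pt t in auto)
    then show "mat (length (map (\<lambda>p. (p div n, p mod n + 1)) [0..<?M])) (length (map (beta lam ?M) [1..<Suc ?M]))
       (\<lambda>(i, j). twist_entry t x (map (\<lambda>p. (p div n, p mod n + 1)) [0..<?M] ! i) (map (beta lam ?M) [1..<Suc ?M] ! j)) $$ (p, j) = 0"
      using pj by (simp del: upt_Suc)
  qed (auto simp: S_def T_def)
qed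

subsection \<open>Residue classes of a beta set\<close>

lemma finite_residue_entries [simp]: "finite (residue_entries t lam m i)"
  by (simp add: residue_entries_def)

lemma set_block_col [simp]: "set (block_col t lam m i) = residue_entries t lam m i"
  by (simp add: block_col_def)

lemma length_block_col [simp]: "length (block_col t lam m i) = residue_count t lam m i"
  by (simp add: block_col_def residue_count_def)

lemma sorted_block_col: "sorted_wrt (>) (block_col t lam m i)"
  by (simp add: block_col_def sorted_wrt_rev)

lemma block_col_mod: "b \<in> set (block_col t lam m i) \<Longrightarrow> b mod t = i"
  by (simp add: residue_entries_def)

lemma block_col_nth:
  assumes "j < residue_count t lam m i"
  shows "block_col t lam m i ! j = t * reduced_beta t lam m i (Suc j) + i"
proof -
  have "block_col t lam m i ! j mod t = i"
    by (rule block_col_mod, rule nth_mem) (use assms in simp)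
  moreover have "reduced_beta t lam m i (Suc j) = block_col t lam m i ! j div t"
    by (simp add: reduced_beta_def block_col_def)
  ultimately show ?thesis
    by (metis mult_div_mod_eq)
qed

lemma reduced_beta_ge:
  assumes "j < residue_count t lam m i"
  shows "residue_count t lam m i \<le> reduced_beta t lam m i (Suc j) + Suc j"
proof -
  let ?l = "residue_count t lam m i" and ?f = "reduced_beta t lam m i"
  have dec: "?f (Suc (Suc j)) < ?f (Suc j)" if "Suc j < ?l" for j
  proof -
    have "block_col t lam m i ! Suc j < block_col t lam m i ! j"
      using sorted_wrt_nth_less[OF sorted_block_col, of j "Suc j" t lam m i] that by simp
    then have "t * ?f (Suc (Suc j)) < t * ?f (Suc j)"
      using block_col_nth[of j t lam m i] block_col_nth[of "Suc j" t lam m i] that by simp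
    then show ?thesis by simp
  qed
  from assms have "j \<le> ?l - 1" by simp
  then show ?thesis
  proof (induction j rule: inc_induct)
    case base
    then show ?case using assms by simp
  next
    case (step j)
    then have "Suc j < ?l" by linarith
    then show ?case using dec[of j] step by linarith
  qed
qed

lemma t_quotient_eq:
  assumes "j < residue_count t lam m i"
  shows "int (t_quotient t lam m i (Suc j))
    = int (reduced_beta t lam m i (Suc j)) + int (Suc j) - int (residue_count t lam m i)"
  using reduced_beta_ge[OF assms] assms by (simp add: t_quotient_def)

lemma sorted_wrt_unique:
  assumes R: "\<And>a b. R a b \<Longrightarrow> \<not> R b a"
    and "sorted_wrt R xs" "sorted_wrt R ys" "set xs = set ys"
  shows "xs = ys"
  using assms(2-4)
proof (induction xs arbitrary: ys)
  case (Cons x xs)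
  then obtain y ys' where ys: "ys = y # ys'" by (cases ys) auto
  have irr: "\<not> R a a" for a using R by blast
  have "x = y"
  proof (rule ccontr)
    assume "x \<noteq> y"
    then have "x \<in> set ys'" "y \<in> set xs" using Cons.prems(3) unfolding ys by auto
    then have "R y x" "R x y" using Cons.prems unfolding ys by auto
    then show False using R by blast
  qed
  moreover have "x \<notin> set xs" "y \<notin> set ys'"
    using Cons.prems irr unfolding ys by auto
  ultimately have "set xs = set ys'"
    using Cons.prems(3) unfolding ys by auto
  then show ?case using Cons \<open>x = y\<close> unfolding ys by simp
qed simp

lemma sorted_wrt_concat_map:
  assumes "\<And>i. i < h \<Longrightarrow> sorted_wrt R (L i)"
    and "\<And>i j a b. i < j \<Longrightarrow> j < h \<Longrightarrow> a \<in> set (L i) \<Longrightarrow> b \<in> set (L j) \<Longrightarrow> R a b"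
  shows "sorted_wrt R (concat (map L [0..<h]))"
  using assms
proof (induction h)
  case (Suc h)
  then have "sorted_wrt R (concat (map L [0..<h]))" by (metis less_SucI)
  then show ?case
    using Suc.prems by (auto simp: sorted_wrt_append)
qed simp

text \<open>Both lists are sorted for the same strict order (residue increasing, then value
  decreasing) and have the same elements.\<close>

lemma sorting_perm_cols:
  assumes "residue_sorting_perm t lam m \<sigma>" and t: "0 < t"
  shows "map (beta lam m \<circ> \<sigma>) [1..<Suc m] = concat (map (block_col t lam m) [0..<t])"
proof -
  define R where "R a b \<longleftrightarrow> a mod t < b mod t \<or> (a mod t = b mod t \<and> b < a)" for a b
  have \<sigma>: "\<sigma> permutes {1..m}" and srt: "\<And>a b. a \<in> {1..m} \<Longrightarrow> b \<in> {1..m} \<Longrightarrow> a < b \<Longrightarrow> R (beta lam m (\<sigma> a)) (beta lam m (\<sigma> b))"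
    using assms by (auto simp: residue_sorting_perm_def R_def)
  show ?thesis
  proof (rule sorted_wrt_unique[where R = R])
    show "\<not> R b a" if "R a b" for a b using that by (auto simp: R_def)
    show "sorted_wrt R (map (beta lam m \<circ> \<sigma>) [1..<Suc m])"
      unfolding sorted_wrt_map
      by (rule sorted_wrt_mono_rel[OF _ sorted_wrt_upt]) (use srt in auto)
    show "sorted_wrt R (concat (map (block_col t lam m) [0..<t]))"
    proof (rule sorted_wrt_concat_map)
      fix i
      show "sorted_wrt R (block_col t lam m i)"
        by (rule sorted_wrt_mono_rel[OF _ sorted_block_col]) (auto simp: R_def residue_entries_def)
    next
      fix i j a b assume "i < j" "a \<in> set (block_col t lam m i)" "b \<in> set (block_col t lam m j)"
      then show "R a b" by (auto simp: R_def residue_entries_def)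
    qed
    have "set (map (beta lam m \<circ> \<sigma>) [1..<Suc m]) = beta lam m ` \<sigma> ` {1..m}"
      by (simp add: image_image atLeastLessThanSuc_atLeastAtMost del: upt_Suc)
    also have "\<dots> = beta lam m ` {1..m}" using permutes_image[OF \<sigma>] by simp
    also have "\<dots> = set (concat (map (block_col t lam m) [0..<t]))"
      using t by (auto simp: residue_entries_def)
    finally show "set (map (beta lam m \<circ> \<sigma>) [1..<Suc m]) = set (concat (map (block_col t lam m) [0..<t]))" .
  qed
qed

subsection \<open>Evaluation of the blocks\<close>

lemma length_block_row [simp]: "length (block_row n i) = n"
  by (simp add: block_row_def)

lemma block_row_nth [simp]: "p < n \<Longrightarrow> block_row n i ! p = (i, Suc p)"
  by (simp add: block_row_def del: upt_Suc)

lemma set_block_row: "set (block_row n i) = {i} \<times> {1..n}"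
  by (auto simp: block_row_def)

lemma twist_entry_partner:
  assumes "b mod t = j" "i < t" "0 < t"
  shows "twist_entry t x (i, k) b = (if j = i then x k powi (int b + 1) else 0)
    - (if j + i + 2 = t \<or> j + i + 2 = 2 * t then x k powi (- (int b + 1)) else 0)"
proof -
  have "(b + i + 2) mod t = (b mod t + i + 2) mod t"
    by (metis add.assoc mod_add_left_eq)
  then show ?thesis
    using partner_residue[of j t i] assms by (auto simp: twist_entry_def)
qed

lemma power_int_collect:
  fixes y :: "'a::field"
  assumes "y \<noteq> 0"
  shows "(y ^ t) powi a = y powi (int t * a)" "inverse (y ^ t) powi a = y powi (- (int t * a))"
  using assms by (simp_all add: power_int_mult power_int_inverse power_int_minus)

text \<open>For residue \<open>t - 1\<close> the exponent \<open>b + 1\<close> is the multiple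
  \<open>t * (u + 1)\<close>, so every entry is already a function of \<open>x^t\<close>.\<close>

lemma sp_block:
  fixes x :: "nat \<Rightarrow> 'a::field"
  assumes x: "\<And>i. 1 \<le> i \<Longrightarrow> i \<le> n \<Longrightarrow> x i \<noteq> 0" and t: "2 \<le> t"
    and cnt: "residue_count t lam m (t - 1) = n"
  shows "list_det (twist_entry t x) (block_row n (t - 1)) (block_col t lam m (t - 1))
    = det_of n (\<lambda>i j. (x i ^ t) powi (int (t_quotient t lam m (t - 1) j) + int n - int j + 1)
        - (x i ^ t) powi (- (int (t_quotient t lam m (t - 1) j) + int n - int j + 1)))"
proof -
  let ?u = "reduced_beta t lam m (t - 1)"
  have "list_det (twist_entry t x) (block_row n (t - 1)) (block_col t lam m (t - 1))
    = det_of n (\<lambda>i j. (x i ^ t) powi (int (?u j) + 1) - (x i ^ t) powi (- (int (?u j) + 1)))"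
    unfolding list_det_def det_of_def
  proof (intro arg_cong[of _ _ det] eq_matI, goal_cases)
    case (1 p j)
    then have p: "p < n" and j: "j < n" by auto
    have b: "block_col t lam m (t - 1) ! j = t * ?u (Suc j) + (t - 1)"
      using block_col_nth[of j t lam m "t - 1"] j cnt by simp
    then have e: "int (block_col t lam m (t - 1) ! j) + 1 = int t * (int (?u (Suc j)) + 1)"
      using t by (simp add: algebra_simps of_nat_diff)
    have "twist_entry t x (t - 1, Suc p) (block_col t lam m (t - 1) ! j)
        = x (Suc p) powi (int t * (int (?u (Suc j)) + 1)) - x (Suc p) powi (- (int t * (int (?u (Suc j)) + 1)))"
      unfolding e[symmetric]
      by (subst twist_entry_partner[OF block_col_mod[OF nth_mem]]) (use t j cnt in auto)
    also have "\<dots> = (x (Suc p) ^ t) powi (int (?u (Suc j)) + 1) - (x (Suc p) ^ t) powi (- (int (?u (Suc j)) + 1))"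
      using x[of "Suc p"] p by (simp add: power_int_collect mult_minus_right del: minus_add_distrib)
    finally show ?case
      using p j cnt by simp
  qed (use cnt in auto)
  also have "\<dots> = det_of n (\<lambda>i j. (x i ^ t) powi (int (t_quotient t lam m (t - 1) j) + int n - int j + 1)
        - (x i ^ t) powi (- (int (t_quotient t lam m (t - 1) j) + int n - int j + 1)))"
  proof (rule det_of_cong)
    fix i j assume "1 \<le> j" "j \<le> n"
    then have "int (t_quotient t lam m (t - 1) j) + int n - int j = int (?u j)"
      using t_quotient_eq[of "j - 1" t lam m "t - 1"] cnt by simp
    then show "(x i ^ t) powi (int (?u j) + 1) - (x i ^ t) powi (- (int (?u j) + 1))
      = (x i ^ t) powi (int (t_quotient t lam m (t - 1) j) + int n - int j + 1)
        - (x i ^ t) powi (- (int (t_quotient t lam m (t - 1) j) + int n - int j + 1))"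
      by (simp only:)
  qed
  finally show ?thesis .
qed

text \<open>With \<open>b = t * u + h\<close> and \<open>t = 2 * (h + 1)\<close>, the exponents
  \<open>b + 1\<close> and \<open>-(b + 1)\<close> equal \<open>t * (u + 1)\<close> and
  \<open>-t * u\<close>, both shifted by \<open>-(h + 1)\<close>. Extracting this common power
  leaves the odd orthogonal numerator.\<close>

lemma so_block:
  fixes x :: "nat \<Rightarrow> 'a::field"
  assumes x: "\<And>i. 1 \<le> i \<Longrightarrow> i \<le> n \<Longrightarrow> x i \<noteq> 0" and t: "t = 2 * h + 2"
    and cnt: "residue_count t lam m h = n"
  shows "list_det (twist_entry t x) (block_row n h) (block_col t lam m h)
    = (\<Prod>i<n. x (Suc i) powi (- int (Suc h))) *
      det_of n (\<lambda>i j. (x i ^ t) powi (int (t_quotient t lam m h j) + int n - int j + 1)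
        - (x i ^ t) powi (- (int (t_quotient t lam m h j) + int n - int j)))"
proof -
  let ?u = "reduced_beta t lam m h"
  let ?a = "\<lambda>i j. (x i ^ t) powi (int (?u j) + 1) - (x i ^ t) powi (- int (?u j))"
  have "list_det (twist_entry t x) (block_row n h) (block_col t lam m h)
      = det (mat n n (\<lambda>(i, j). x (Suc i) powi (- int (Suc h)) * 1 * ?a (i + 1) (j + 1)))"
    unfolding list_det_def
  proof (intro arg_cong[of _ _ det] eq_matI, goal_cases)
    case (1 p j)
    then have p: "p < n" and j: "j < n" by auto
    have b: "block_col t lam m h ! j = t * ?u (Suc j) + h"
      using block_col_nth[of j t lam m h] j cnt by simp
    have x0: "x (Suc p) \<noteq> 0" using x p by simp
    have "twist_entry t x (h, Suc p) (block_col t lam m h ! j)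
        = x (Suc p) powi (int (block_col t lam m h ! j) + 1) - x (Suc p) powi (- (int (block_col t lam m h ! j) + 1))"
      by (subst twist_entry_partner[OF block_col_mod[OF nth_mem]]) (use t j cnt in auto)
    also have "int (block_col t lam m h ! j) + 1 = - int (Suc h) + int t * (int (?u (Suc j)) + 1)"
      unfolding b by (simp add: t algebra_simps)
    also have "- (- int (Suc h) + int t * (int (?u (Suc j)) + 1)) = - int (Suc h) + - (int t * int (?u (Suc j)))"
      by (simp add: t algebra_simps)
    finally have "twist_entry t x (h, Suc p) (block_col t lam m h ! j)
      = x (Suc p) powi (- int (Suc h)) * ?a (Suc p) (Suc j)"
      using x0 by (simp only: power_int_add[OF disjI1[OF x0]] power_int_collect[OF x0] right_diff_distrib mult_minus_right)
    then show ?case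
      using p j cnt by simp
  qed (use cnt in auto)
  also have "\<dots> = (\<Prod>i<n. x (Suc i) powi (- int (Suc h))) * (\<Prod>j<n. 1) * det (mat n n (\<lambda>(i, j). ?a (i + 1) (j + 1)))"
    by (rule det_scale)
  also have "det (mat n n (\<lambda>(i, j). ?a (i + 1) (j + 1))) = det_of n ?a"
    by (simp add: det_of_def)
  also have "\<dots> = det_of n (\<lambda>i j. (x i ^ t) powi (int (t_quotient t lam m h j) + int n - int j + 1)
        - (x i ^ t) powi (- (int (t_quotient t lam m h j) + int n - int j)))"
  proof (rule det_of_cong)
    fix i j assume "1 \<le> j" "j \<le> n"
    then have "int (t_quotient t lam m h j) + int n - int j = int (?u j)"
      using t_quotient_eq[of "j - 1" t lam m h] cnt by simp
    then show "?a i j = (x i ^ t) powi (int (t_quotient t lam m h j) + int n - int j + 1)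
        - (x i ^ t) powi (- (int (t_quotient t lam m h j) + int n - int j))"
      by (simp only:)
  qed
  finally show ?thesis
    by simp
qed

text \<open>Reversing the columns of class \<open>i'\<close> puts the exponents of
  \<open>x^t\<close> in decreasing order; row and column factors then match a Schur numerator. The
  sign collects the reversal, a factor -1 for each of the \<open>N i'\<close> columns, and -1 for
  each pair of rows of the same variable.\<close>

lemma schur_block:
  fixes x :: "nat \<Rightarrow> 'a::field" and lam :: "nat \<Rightarrow> nat"
  assumes x: "\<And>i. 1 \<le> i \<Longrightarrow> i \<le> n \<Longrightarrow> x i \<noteq> 0" and i: "i < i'" "i + i' + 2 = t"
  defines "N \<equiv> residue_count t lam (t * n)"
  assumes cnt: "N i + N i' = 2 * n"
  shows "list_det (twist_entry t x) (block_row n i @ block_row n i')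
      (block_col t lam (t * n) i @ block_col t lam (t * n) i')
    = (-1) ^ (n + (Suc (N i') choose 2)) *
      det_of (2 * n) (\<lambda>k j. doubled_vars n t x k powi (mu1 t n lam i j + int (2 * n) - int j))"
proof -
  let ?C = "block_col t lam (t * n)" and ?R = "block_row n"
  let ?q = "t_quotient t lam (t * n)" and ?f = "twist_entry t x"
  \<comment> \<open>One more than the largest reduced entry of class \<open>i'\<close>, or 0 if the
    class is empty; shifting by \<open>M\<close> makes the exponents \<open>M - v - 1\<close> of
    that class non-negative.\<close>
  define M where "M = int (?q i' 1) + int (N i')"
  define r where "r p = (if p < n then x (Suc p) powi (int (Suc i) - int t * M)
     else - (x (Suc (p - n)) powi (int t * M - int (Suc i))))" for p
  define c where "c j = (if j < N i then 1 else - 1 :: 'a)" for j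
  let ?a = "\<lambda>k j. doubled_vars n t x (k + 1) powi (mu1 t n lam i (j + 1) + int (2 * n) - int (j + 1))"
  have it: "i < t" "i' < t" "0 < t" "t - 2 - i = i'" using i by auto
  have entry: "?f ((?R i @ ?R i') ! p) ((?C i @ rev (?C i')) ! j) = r p * c j * ?a p j"
    if p: "p < 2 * n" and j: "j < 2 * n" for p j
  proof -
    define k where "k = (if p < n then Suc p else Suc (p - n))"
    have k0: "x k \<noteq> 0" using p x by (auto simp: k_def)
    have row: "(?R i @ ?R i') ! p = (if p < n then (i, k) else (i', k))"
      using p by (auto simp: nth_append k_def)
    have r: "r p = (if p < n then x k powi (int (Suc i) - int t * M) else - (x k powi (int t * M - int (Suc i))))"
      by (simp add: r_def k_def)
    have z: "doubled_vars n t x (p + 1) powi e = x k powi (if p < n then int t * e else - (int t * e))" for e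
      using k0 by (auto simp: doubled_vars_def k_def power_int_collect Suc_diff_le)
    show ?thesis
    proof (cases "j < N i")
      case True
      let ?u = "reduced_beta t lam (t * n) i (Suc j)"
      have col: "(?C i @ rev (?C i')) ! j = t * ?u + i"
        using True block_col_nth[of j t lam "t * n" i] by (simp add: nth_append N_def)
      have "mu1 t n lam i (j + 1) + int (2 * n) - int (j + 1) = M + int ?u"
        using True t_quotient_eq[of j t lam "t * n" i] cnt
        unfolding mu1_def Let_def it(4) by (simp add: M_def N_def del: of_nat_Suc)
      moreover have "?f (i, k) (t * ?u + i) = x k powi (int (t * ?u + i) + 1)"
        by (subst twist_entry_partner[of _ t i]) (use i it in auto)
      moreover have "?f (i', k) (t * ?u + i) = - (x k powi (- (int (t * ?u + i) + 1)))"
        by (subst twist_entry_partner[of _ t i]) (use i it in auto)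
      ultimately show ?thesis
        using True k0 unfolding row r z col c_def
        by (auto simp: power_int_add[symmetric] algebra_simps)
    next
      case False
      define l where "l = 2 * n - Suc j"
      have l: "l < N i'" using False j cnt by (simp add: l_def)
      let ?v = "reduced_beta t lam (t * n) i' (Suc l)"
      have "(?C i @ rev (?C i')) ! j = ?C i' ! l"
        using False j cnt by (simp add: nth_append rev_nth N_def l_def) (simp add: algebra_simps)
      then have col: "(?C i @ rev (?C i')) ! j = t * ?v + i'"
        using l block_col_nth[of l t lam "t * n" i'] by (simp add: N_def)
      \<comment> \<open>The reversed index in \<open>mu1\<close> is the original position in class
        \<open>i'\<close>.\<close>
      have "2 * n + 1 - (j + 1) = Suc l" using j by (simp add: l_def)
      then have E: "mu1 t n lam i (j + 1) + int (2 * n) - int (j + 1) = M - int ?v - 1"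
        using False j l t_quotient_eq[of l t lam "t * n" i'] 
        unfolding mu1_def Let_def it(4) by (simp add: M_def N_def l_def of_nat_diff)
      have e: "int (t * ?v + i') + 1 = int t * int ?v + int t - int (Suc i)" using i by simp
      have f: "?f (i, k) (t * ?v + i') = - (x k powi (- (int t * int ?v + int t - int (Suc i))))"
        unfolding e[symmetric] by (subst twist_entry_partner[of _ t i']) (use i it in auto)
      have f': "?f (i', k) (t * ?v + i') = x k powi (int t * int ?v + int t - int (Suc i))"
        unfolding e[symmetric] by (subst twist_entry_partner[of _ t i']) (use i it in auto)
      show ?thesis
        using False k0 unfolding row r z col c_def E
        by (cases "p < n"; simp only: if_True if_False f f')
          (simp_all add: power_int_add[symmetric] algebra_simps)
    qed
  qed
  have len: "length (?R i @ ?R i') = 2 * n" "length (?C i @ rev (?C i')) = 2 * n"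
    using cnt by (simp_all add: N_def)
  have "rearranges (N i' choose 2) (?C i @ ?C i') (?C i @ rev (?C i'))"
    using rearranges_prefix[OF rearranges_rev[of "?C i'"], of "?C i"] by (simp add: N_def)
  then have "list_det ?f (?R i @ ?R i') (?C i @ ?C i')
      = (-1) ^ (N i' choose 2) * list_det ?f (?R i @ ?R i') (?C i @ rev (?C i'))"
    by (rule list_det_rearrange_cols)
  also have "list_det ?f (?R i @ ?R i') (?C i @ rev (?C i'))
      = det (mat (2 * n) (2 * n) (\<lambda>(p, j). r p * c j * ?a p j))"
    unfolding list_det_def len by (intro arg_cong[of _ _ det] eq_matI) (simp_all add: entry)
  also have "\<dots> = (\<Prod>p<2 * n. r p) * (\<Prod>j<2 * n. c j) * det (mat (2 * n) (2 * n) (\<lambda>(p, j). ?a p j))"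
    by (rule det_scale)
  also have "(\<Prod>p<2 * n. r p) = (-1) ^ n"
  proof -
    have "(\<Prod>p<2 * n. r p) = (\<Prod>p<n. r p) * (\<Prod>p<n. r (p + n))"
      using prod.atLeastLessThan_concat[of 0 n "2 * n" r] prod.shift_bounds_nat_ivl[of r 0 n n]
      by (simp add: lessThan_atLeast0 mult_2)
    also have "\<dots> = (\<Prod>p<n. r p * r (p + n))"
      by (simp add: prod.distrib)
    also have "\<dots> = (\<Prod>p<n. - 1)"
    proof (rule prod.cong[OF refl])
      \<comment> \<open>The rows of \<open>x\<close> and of its inverse have opposite exponents, so
        the powers cancel and only -1 remains.\<close>
      fix p assume "p \<in> {..<n}"
      then have "x (Suc p) \<noteq> 0" using x by simp
      then show "r p * r (p + n) = - 1"
        using \<open>p \<in> {..<n}\<close> by (simp add: r_def power_int_add[symmetric])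
    qed
    finally show ?thesis by simp
  qed
  also have "(\<Prod>j<2 * n. c j) = (-1) ^ N i'"
  proof -
    have "(\<Prod>j<2 * n. c j) = (\<Prod>j<N i. c j) * (\<Prod>j = N i..<N i + N i'. c j)"
      using prod.atLeastLessThan_concat[of 0 "N i" "N i + N i'" c] cnt by (simp add: lessThan_atLeast0)
    also have "\<dots> = (\<Prod>j<N i. 1) * (\<Prod>j = N i..<N i + N i'. - 1)"
      by (intro arg_cong2[of _ _ _ _ "(*)"] prod.cong) (auto simp: c_def)
    finally show ?thesis by simp
  qed
  finally show ?thesis
    by (simp add: det_of_def power_add numeral_2_eq_2 mult_ac)
qed

subsection \<open>Factorization of the determinant\<close>

lemma upt_fold:
  "[0..<2 * h + c + 1] = [0..<h] @ [h..<h + c] @ map (\<lambda>i. 2 * h + c - 1 - i) (rev [0..<h]) @ [2 * h + c]"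
proof -
  have "map (\<lambda>i. 2 * h + c - 1 - i) (rev [0..<h]) = [h + c..<2 * h + c]"
    by (rule nth_equalityI) (auto simp: rev_nth)
  moreover have "[0..<2 * h + c] = [0..<h] @ [h..<h + c] @ [h + c..<2 * h + c]"
  proof -
    have "[0..<h + (h + c)] = [0..<h] @ [h..<h + (h + c)]" by (rule upt_add_eq_append) simp
    moreover have "[h..<h + c + h] = [h..<h + c] @ [h + c..<h + c + h]" by (rule upt_add_eq_append) simp
    moreover have "h + (h + c) = 2 * h + c" "h + c + h = 2 * h + c" by simp_all
    ultimately show ?thesis by (simp only:)
  qed
  ultimately show ?thesis by simp
qed

text \<open>The residues \<open>0\<close> to \<open>t - 2\<close> are paired palindromically around
  the middle class, which is the pattern of \<open>rearranges_pairs\<close>; residue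
  \<open>t - 1\<close> stays last.\<close>

lemma rearranges_fold:
  assumes t: "t = 2 * h + c + 1"
    and even: "\<And>i. i < h \<Longrightarrow> even (length (L i) + length (L (t - 2 - i)))"
  shows "rearranges (length (concat (map L [h..<h + c])) * (\<Sum>i<h. length (L (t - 2 - i))))
    (concat (map L [0..<t]))
    (concat (map (\<lambda>i. L i @ L (t - 2 - i)) [0..<h]) @ concat (map L [h..<h + c]) @ L (t - 1))"
proof -
  have "map L [0..<t] = map L [0..<h] @ map L [h..<h + c] @ map (\<lambda>i. L (t - 2 - i)) (rev [0..<h]) @ [L (t - 1)]"
    unfolding t upt_fold by (simp add: comp_def del: upt_Suc)
  then have eq: "concat (map L [0..<t]) = (concat (map L [0..<h]) @ concat (map L [h..<h + c]) @
      concat (map (\<lambda>i. L (t - 2 - i)) (rev [0..<h]))) @ L (t - 1)"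
    by simp
  show ?thesis
    unfolding eq
    using rearranges_suffix[OF rearranges_pairs[of h L "\<lambda>i. L (t - 2 - i)" "concat (map L [h..<h + c])"], of "L (t - 1)"] even
    by simp
qed

lemma block_entry_zero:
  assumes "r \<in> set (block_row n i)" "b \<in> set (block_col t lam m j)"
    "i < t" "j \<noteq> i" "j + i + 2 \<noteq> t" "j + i + 2 \<noteq> 2 * t"
  shows "twist_entry t x r b = 0"
proof -
  from assms obtain k where "r = (i, k)" by (auto simp: set_block_row)
  then show ?thesis
    using twist_entry_zero[of t i b x k] assms block_col_mod[OF assms(2)] by simp
qed

definition quotient_numerator :: "nat \<Rightarrow> nat \<Rightarrow> (nat \<Rightarrow> 'a::field) \<Rightarrow> (nat \<Rightarrow> nat) \<Rightarrow> 'a" where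
  "quotient_numerator t n x lam =
    det_of n (\<lambda>i j. (x i ^ t) powi (int (t_quotient t lam (t * n) (t - 1) j) + int n - int j + 1)
        - (x i ^ t) powi (- (int (t_quotient t lam (t * n) (t - 1) j) + int n - int j + 1))) *
    (\<Prod>i<(t - 1) div 2. det_of (2 * n) (\<lambda>k j. doubled_vars n t x k powi (mu1 t n lam i j + int (2 * n) - int j))) *
    (if even t then
       det_of n (\<lambda>i j. (x i ^ t) powi (int (t_quotient t lam (t * n) (t div 2 - 1) j) + int n - int j + 1)
        - (x i ^ t) powi (- (int (t_quotient t lam (t * n) (t div 2 - 1) j) + int n - int j)))
     else 1)"

text \<open>The first summand comes from moving the middle columns across the second members of the
  pairs, the second from \<open>schur_block\<close>.\<close>

definition block_sign :: "nat \<Rightarrow> nat \<Rightarrow> (nat \<Rightarrow> nat) \<Rightarrow> nat" where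
  "block_sign t n lam =
    (if even t then n * (\<Sum>i<(t - 1) div 2. residue_count t lam (t * n) (t - 2 - i)) else 0) +
    (\<Sum>i<(t - 1) div 2. n + (Suc (residue_count t lam (t * n) (t - 2 - i)) choose 2))"

definition balanced :: "nat \<Rightarrow> nat \<Rightarrow> (nat \<Rightarrow> nat) \<Rightarrow> bool" where
  "balanced t n lam \<longleftrightarrow> residue_count t lam (t * n) (t - 1) = n \<and>
    (\<forall>i<t - 1. residue_count t lam (t * n) i + residue_count t lam (t * n) (t - 2 - i) = 2 * n)"

text \<open>\<open>K\<close> holds the sign of the row reordering and the powers of \<open>x\<close>
  from the orthogonal block. It must serve all balanced \<open>lam\<close> at once, so that it
  cancels against the empty partition.\<close>

lemma twisted_det_eval:
  fixes x :: "nat \<Rightarrow> 'a::field"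
  assumes x: "\<And>i. 1 \<le> i \<Longrightarrow> i \<le> n \<Longrightarrow> x i \<noteq> 0" and t2: "2 \<le> t"
  obtains K where "\<And>lam. balanced t n lam \<Longrightarrow>
     list_det (twist_entry t x) (concat (map (block_row n) [0..<t])) (concat (map (block_col t lam (t * n)) [0..<t]))
     = K * (-1) ^ block_sign t n lam * quotient_numerator t n x lam"
proof -
  define h where "h = (t - 1) div 2"
  define c where "c = (if even t then 1 else 0 :: nat)"
  have t: "t = 2 * h + c + 1" using t2 by (auto simp: h_def c_def elim!: evenE oddE)
  have c01: "c = 0 \<and> odd t \<or> c = 1 \<and> even t" by (simp add: c_def)
  define K where "K = (-1) ^ (c * n * (\<Sum>i<h. n)) *
    (if even t then (\<Prod>i<n. x (Suc i) powi (- int (Suc h))) else 1)"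
  let ?f = "twist_entry t x" and ?R = "block_row n"
  have "list_det ?f (concat (map ?R [0..<t])) (concat (map (block_col t lam (t * n)) [0..<t]))
     = K * (-1) ^ block_sign t n lam * quotient_numerator t n x lam" if bal: "balanced t n lam" for lam
  proof -
    let ?C = "block_col t lam (t * n)" and ?N = "residue_count t lam (t * n)"
    have last: "?N (t - 1) = n" and pair: "\<And>i. i < t - 1 \<Longrightarrow> ?N i + ?N (t - 2 - i) = 2 * n"
      using bal by (auto simp: balanced_def)
    have mid: "?N h = n" if "c = 1" using pair[of h] that t by simp
    let ?MR = "concat (map ?R [h..<h + c])" and ?MC = "concat (map ?C [h..<h + c])"
    have MR: "?MR = (if even t then ?R h else [])" and MC: "?MC = (if even t then ?C h else [])"
      using c01 by auto
    let ?PR = "\<lambda>i. ?R i @ ?R (t - 2 - i)" and ?PC = "\<lambda>i. ?C i @ ?C (t - 2 - i)"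
    have "rearranges (length ?MR * (\<Sum>i<h. length (?R (t - 2 - i)))) (concat (map ?R [0..<t]))
        (concat (map ?PR [0..<h]) @ ?MR @ ?R (t - 1))"
      by (rule rearranges_fold[OF t]) simp
    moreover have "length ?MR = c * n" using c01 MR by auto
    ultimately have rrows: "rearranges (c * n * (\<Sum>i<h. n)) (concat (map ?R [0..<t]))
        (concat (map ?PR [0..<h]) @ ?MR @ ?R (t - 1))" by simp
    have "rearranges (length ?MC * (\<Sum>i<h. length (?C (t - 2 - i)))) (concat (map ?C [0..<t]))
        (concat (map ?PC [0..<h]) @ ?MC @ ?C (t - 1))"
      by (rule rearranges_fold[OF t]) (use pair t in simp)
    moreover have lenMC: "length ?MC = c * n" using c01 MC mid by auto
    ultimately have rcols: "rearranges (c * n * (\<Sum>i<h. ?N (t - 2 - i))) (concat (map ?C [0..<t]))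
        (concat (map ?PC [0..<h]) @ ?MC @ ?C (t - 1))" by simp
    have sgn: "block_sign t n lam = c * n * (\<Sum>i<h. ?N (t - 2 - i)) + (\<Sum>i<h. n + (Suc (?N (t - 2 - i)) choose 2))"
      by (simp add: block_sign_def c_def h_def)
    have "list_det ?f (concat (map ?R [0..<t])) (concat (map ?C [0..<t]))
      = (-1) ^ (c * n * (\<Sum>i<h. n)) * ((-1) ^ (c * n * (\<Sum>i<h. ?N (t - 2 - i))) *
        list_det ?f (concat (map ?PR [0..<h]) @ ?MR @ ?R (t - 1)) (concat (map ?PC [0..<h]) @ ?MC @ ?C (t - 1)))"
      unfolding list_det_rearrange_rows[OF rrows] list_det_rearrange_cols[OF rcols]
      by (simp only: mult.left_commute)
    also have "list_det ?f (concat (map ?PR [0..<h]) @ ?MR @ ?R (t - 1)) (concat (map ?PC [0..<h]) @ ?MC @ ?C (t - 1))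
      = list_det ?f (concat (map ?PR [0..<h])) (concat (map ?PC [0..<h])) *
        list_det ?f (?MR @ ?R (t - 1)) (?MC @ ?C (t - 1))"
    proof (rule list_det_block_diag)
      have "length (?PR i) = length (?PC i)" if "i < h" for i using pair[of i] that t by simp
      then show "length (concat (map ?PR [0..<h])) = length (concat (map ?PC [0..<h]))"
        by (auto simp: length_concat comp_def intro!: arg_cong[of _ _ sum_list])
      show "length (?MR @ ?R (t - 1)) = length (?MC @ ?C (t - 1))"
        using MR lenMC last c01 by auto
    next
      fix r b assume "r \<in> set (concat (map ?PR [0..<h]))" "b \<in> set (?MC @ ?C (t - 1))"
      then have "\<exists>i<h. r \<in> set (?R i) \<or> r \<in> set (?R (t - 2 - i))"
        and "(even t \<and> b \<in> set (?C h)) \<or> b \<in> set (?C (t - 1))"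
        unfolding MC by (auto simp del: set_block_col split: if_splits)
      then obtain i i' j where ij: "i < h" "i' = i \<or> i' = t - 2 - i" "r \<in> set (?R i')"
        "(j = h \<and> even t) \<or> j = t - 1" "b \<in> set (?C j)"
        by blast
      show "?f r b = 0"
        by (rule block_entry_zero[OF ij(3,5)]) (use ij(1,2,4) t c01 in auto)
    next
      fix r b assume "r \<in> set (?MR @ ?R (t - 1))" "b \<in> set (concat (map ?PC [0..<h]))"
      then have "\<exists>i<h. b \<in> set (?C i) \<or> b \<in> set (?C (t - 2 - i))"
        and "(even t \<and> r \<in> set (?R h)) \<or> r \<in> set (?R (t - 1))"
        unfolding MR by (auto simp del: set_block_col split: if_splits)
      then obtain i i' j where ij: "i < h" "i' = i \<or> i' = t - 2 - i" "b \<in> set (?C i')"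
        "(j = h \<and> even t) \<or> j = t - 1" "r \<in> set (?R j)"
        by blast
      show "?f r b = 0"
        by (rule block_entry_zero[OF ij(5,3)]) (use ij(1,2,4) t c01 in auto)
    qed
    also have "list_det ?f (concat (map ?PR [0..<h])) (concat (map ?PC [0..<h]))
        = (\<Prod>i<h. list_det ?f (?PR i) (?PC i))"
    proof (rule list_det_blocks)
      show "length (?PR i) = length (?PC i)" if "i < h" for i using pair[of i] that t by simp
    next
      fix i j r b assume h: "i < h" "j < h" "i \<noteq> j" and "r \<in> set (?PR i)" "b \<in> set (?PC j)"
      then have "r \<in> set (?R i) \<or> r \<in> set (?R (t - 2 - i))" "b \<in> set (?C j) \<or> b \<in> set (?C (t - 2 - j))"
        by (auto simp del: set_block_col)
      then obtain i' j' where ij: "i' = i \<or> i' = t - 2 - i" "r \<in> set (?R i')"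
        "j' = j \<or> j' = t - 2 - j" "b \<in> set (?C j')"
        by blast
      show "?f r b = 0"
        by (rule block_entry_zero[OF ij(2,4)]) (use h ij(1,3) t in auto)
    qed
    also have "list_det ?f (?MR @ ?R (t - 1)) (?MC @ ?C (t - 1))
        = list_det ?f ?MR ?MC * list_det ?f (?R (t - 1)) (?C (t - 1))"
    proof (rule list_det_block_diag)
      show "length ?MR = length ?MC" using MR lenMC c01 by auto
      show "length (?R (t - 1)) = length (?C (t - 1))" using last by simp
    next
      fix r b assume "r \<in> set ?MR" "b \<in> set (?C (t - 1))"
      then have "r \<in> set (?R h)" "even t" unfolding MR by (auto split: if_splits)
      then show "?f r b = 0"
        by (intro block_entry_zero[OF _ \<open>b \<in> set (?C (t - 1))\<close>]) (use t c01 in auto)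
    next
      fix r b assume "r \<in> set (?R (t - 1))" "b \<in> set ?MC"
      then have "b \<in> set (?C h)" "even t" unfolding MC by (auto split: if_splits)
      then show "?f r b = 0"
        by (intro block_entry_zero[OF \<open>r \<in> set (?R (t - 1))\<close>]) (use t c01 in auto)
    qed
    also have "(\<Prod>i<h. list_det ?f (?PR i) (?PC i)) = (\<Prod>i<h. (-1) ^ (n + (Suc (?N (t - 2 - i)) choose 2)) *
        det_of (2 * n) (\<lambda>k j. doubled_vars n t x k powi (mu1 t n lam i j + int (2 * n) - int j)))"
    proof (rule prod.cong[OF refl])
      fix i assume "i \<in> {..<h}"
      then show "list_det ?f (?PR i) (?PC i) = (-1) ^ (n + (Suc (?N (t - 2 - i)) choose 2)) *
        det_of (2 * n) (\<lambda>k j. doubled_vars n t x k powi (mu1 t n lam i j + int (2 * n) - int j))"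
        by (intro schur_block x pair) (use t in auto)
    qed
    also have "\<dots> = (-1) ^ (\<Sum>i<h. n + (Suc (?N (t - 2 - i)) choose 2)) *
        (\<Prod>i<h. det_of (2 * n) (\<lambda>k j. doubled_vars n t x k powi (mu1 t n lam i j + int (2 * n) - int j)))"
      by (simp only: prod.distrib power_sum)
    also have "list_det ?f ?MR ?MC = (if even t then (\<Prod>i<n. x (Suc i) powi (- int (Suc h))) else 1) *
       (if even t then
       det_of n (\<lambda>i j. (x i ^ t) powi (int (t_quotient t lam (t * n) (t div 2 - 1) j) + int n - int j + 1)
        - (x i ^ t) powi (- (int (t_quotient t lam (t * n) (t div 2 - 1) j) + int n - int j)))
     else 1)"
    proof (cases "even t")
      case True
      then have h: "t = 2 * h + 2" "t div 2 - 1 = h" and "c = 1" using t c01 by auto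
      show ?thesis
        unfolding MR MC h(2) if_P[OF True] by (rule so_block[OF x h(1)]) (use mid \<open>c = 1\<close> in auto)
    next
      case False
      then show ?thesis by (simp add: MR MC list_det_def)
    qed
    also have "list_det ?f (?R (t - 1)) (?C (t - 1)) =
      det_of n (\<lambda>i j. (x i ^ t) powi (int (t_quotient t lam (t * n) (t - 1) j) + int n - int j + 1)
        - (x i ^ t) powi (- (int (t_quotient t lam (t * n) (t - 1) j) + int n - int j + 1)))"
      by (rule sp_block[OF x t2 last])
    finally show ?thesis
      unfolding quotient_numerator_def K_def sgn power_add[of _ "c * n * _"] h_def[symmetric]
      by (simp only: mult_ac)
  qed
  then show thesis by (rule that)
qed

subsection \<open>The empty partition\<close>

lemma block_col_empty:
  assumes "i < t"
  shows "block_col t (\<lambda>_. 0) (t * n) i = rev (map (\<lambda>q. t * q + i) [0..<n])"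
proof -
  have "beta (\<lambda>_. 0) (t * n) ` {1..t * n} = {..<t * n}"
  proof
    show "{..<t * n} \<subseteq> beta (\<lambda>_. 0) (t * n) ` {1..t * n}"
    proof
      fix b assume "b \<in> {..<t * n}"
      then show "b \<in> beta (\<lambda>_. 0) (t * n) ` {1..t * n}"
        by (intro image_eqI[of _ _ "t * n - b"]) (auto simp: beta_def)
    qed
  qed (auto simp: beta_def)
  then have E: "residue_entries t (\<lambda>_. 0) (t * n) i = {b. b < t * n \<and> b mod t = i}"
    by (auto simp: residue_entries_def)
  have "{b. b < t * n \<and> b mod t = i} = (\<lambda>q. t * q + i) ` {0..<n}"
  proof (intro subset_antisym subsetI)
    fix b assume "b \<in> {b. b < t * n \<and> b mod t = i}"
    then have "b div t \<in> {0..<n}" "b = t * (b div t) + i"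
      by (auto simp: less_mult_imp_div_less mult.commute)
    then show "b \<in> (\<lambda>q. t * q + i) ` {0..<n}" by blast
  next
    fix b assume "b \<in> (\<lambda>q. t * q + i) ` {0..<n}"
    then obtain q where q: "q < n" "b = t * q + i" by auto
    then have "t * Suc q \<le> t * n" by (intro mult_le_mono2) simp
    then show "b \<in> {b. b < t * n \<and> b mod t = i}" using q assms by simp
  qed
  then have "sorted_list_of_set (residue_entries t (\<lambda>_. 0) (t * n) i) = map (\<lambda>q. t * q + i) [0..<n]"
    unfolding E using assms
    by (intro strict_sorted_equal) (auto simp: sorted_wrt_map intro!: sorted_wrt_mono_rel[OF _ sorted_wrt_upt])
  then show ?thesis by (simp add: block_col_def)
qed

lemma residue_count_empty: "i < t \<Longrightarrow> residue_count t (\<lambda>_. 0) (t * n) i = n"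
  using length_block_col[of t "\<lambda>_. 0" "t * n" i] by (simp add: block_col_empty del: length_block_col)

lemma t_quotient_empty:
  assumes "i < t"
  shows "t_quotient t (\<lambda>_. 0) (t * n) i j = 0"
proof (cases "1 \<le> j \<and> j \<le> n")
  case True
  then have "j - 1 < n" "n - Suc (j - 1) = n - j" by linarith+
  then have "block_col t (\<lambda>_. 0) (t * n) i ! (j - 1) = t * (n - j) + i"
    unfolding block_col_empty[OF assms] by (simp add: rev_nth)
  then have "reduced_beta t (\<lambda>_. 0) (t * n) i j = n - j"
    using assms by (simp add: reduced_beta_def block_col_def)
  then show ?thesis using True by (simp add: t_quotient_def residue_count_empty[OF assms])
next
  case False
  then show ?thesis by (auto simp: t_quotient_def residue_count_empty[OF assms])
qed

lemma mu1_empty: "i < (t - 1) div 2 \<Longrightarrow> mu1 t n (\<lambda>_. 0) i j = 0"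
  using t_quotient_empty[of i t n] t_quotient_empty[of "t - 2 - i" t n] by (auto simp: mu1_def Let_def)

lemma balanced_empty: "2 \<le> t \<Longrightarrow> balanced t n (\<lambda>_. 0)"
  by (simp add: balanced_def residue_count_empty)

text \<open>All quotients of the empty partition vanish, so these factors are the denominators of
  the characters on the right-hand side.\<close>

lemma quotient_numerator_empty:
  assumes "2 \<le> t"
  shows "quotient_numerator t n x (\<lambda>_. 0) = sp_denom n (\<lambda>i. x i ^ t) *
    (\<Prod>i<(t - 1) div 2. det_of (2 * n) (\<lambda>k j. doubled_vars n t x k powi (int (2 * n) - int j))) *
    (if even t then det_of n (\<lambda>i j. (x i ^ t) powi (int n - int j + 1) - (x i ^ t) powi (- (int n - int j))) else 1)"
  unfolding quotient_numerator_def sp_denom_def using assms by (simp add: t_quotient_empty mu1_empty)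

subsection \<open>Signs\<close>

text \<open>With the local \<open>c\<close>, \<open>h\<close>, \<open>S\<close>, \<open>B\<close>
  and \<open>T\<close>, the sum \<open>B\<close> cancels exactly. What remains is
  \<open>c n (r + S + h n) + T (h + (t choose 2) + c) + 2 h n\<close>, and both brackets are even:
  the first by the rank parity, the second by a case split on \<open>c\<close>.\<close>

lemma sign_exponent_parity:
  assumes t: "2 \<le> t"
    and r: "even (r + (\<Sum>i<(t - 1) div 2. residue_count t lam (t * n) (t - 2 - i) + n))"
  shows "even (int (block_sign t n lam + (t choose 2) * (Suc n choose 2) + block_sign t n (\<lambda>_. 0))
    + sign_exponent t n lam r)"
proof -
  define h where "h = (t - 1) div 2"
  define c where "c = (if even t then 1 else 0 :: nat)"
  have t_eq: "t = 2 * h + c + 1" using t by (auto simp: h_def c_def elim!: evenE oddE)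
  have c01: "c = 0 \<and> odd t \<or> c = 1 \<and> even t" by (simp add: c_def)
  define N where "N i = residue_count t lam (t * n) (t - 2 - i)" for i
  define B where "B = (\<Sum>i<h. Suc (N i) choose 2)"
  define S where "S = (\<Sum>i<h. N i)"
  define T where "T = Suc n choose 2"
  \<comment> \<open>The summation range is exactly the set of the larger partners
    \<open>t - 2 - i\<close> with \<open>i < h\<close>, listed backwards.\<close>
  have sum: "(\<Sum>i = t div 2..t - 2. int ((residue_count t lam (t * n) i + 1) choose 2)) = int B"
  proof -
    have "B = (\<Sum>i<h. (residue_count t lam (t * n) (t - 2 - (h - Suc i)) + 1) choose 2)"
      unfolding B_def N_def using sum.nat_diff_reindex[of "\<lambda>i. Suc (residue_count t lam (t * n) (t - 2 - i)) choose 2" h]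
      by simp
    also have "\<dots> = (\<Sum>i<h. (residue_count t lam (t * n) (i + t div 2) + 1) choose 2)"
    proof (rule sum.cong[OF refl])
      fix i assume "i \<in> {..<h}"
      then have "t - 2 - (h - Suc i) = i + t div 2" using t_eq c01 by auto
      then show "(residue_count t lam (t * n) (t - 2 - (h - Suc i)) + 1) choose 2
        = (residue_count t lam (t * n) (i + t div 2) + 1) choose 2" by simp
    qed
    also have "\<dots> = (\<Sum>i\<in>{0 + t div 2..<h + t div 2}. (residue_count t lam (t * n) i + 1) choose 2)"
      unfolding sum.shift_bounds_nat_ivl by (simp add: lessThan_atLeast0)
    also have "{0 + t div 2..<h + t div 2} = {t div 2..t - 2}"
      using t_eq c01 t by auto
    finally show ?thesis by simp
  qed
  have T: "n * (n + 1) div 2 = T"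
    by (simp add: T_def choose_two)
  have e1: "block_sign t n lam = c * n * S + (h * n + B)"
    by (simp add: block_sign_def c_def h_def S_def B_def N_def sum.distrib)
  have e2: "block_sign t n (\<lambda>_. 0) = c * n * (h * n) + (h * n + h * T)"
  proof -
    have "residue_count t (\<lambda>_. 0) (t * n) (t - 2 - i) = n" if "i < h" for i
      using t by (intro residue_count_empty) simp
    then have "(\<Sum>i<h. residue_count t (\<lambda>_. 0) (t * n) (t - 2 - i)) = (\<Sum>i<h. n)"
      "(\<Sum>i<h. n + (Suc (residue_count t (\<lambda>_. 0) (t * n) (t - 2 - i)) choose 2)) = (\<Sum>i<h. n + T)"
      unfolding T_def by (intro sum.cong; simp)+
    then show ?thesis
      unfolding block_sign_def h_def[symmetric] by (simp add: c_def distrib_left)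
  qed
  have e3: "sign_exponent t n lam r = - int B + int (c * (T + n * r))"
    unfolding sign_exponent_def sum T by (simp add: c_def)
  have ev1: "even (r + S + h * n)"
    using r unfolding h_def[symmetric] by (simp add: S_def N_def sum.distrib add.assoc)
  have ev2: "even (h + (t choose 2) + c)"
  proof (cases "c = 0")
    case True
    then have "t choose 2 = h * (2 * h + 1)" using t_eq by (simp add: choose_two)
    then show ?thesis using True by simp
  next
    case False
    then have "c = 1" using c01 by auto
    then have "t = 2 * (h + 1)" using t_eq by simp
    then have "t choose 2 = (h + 1) * (2 * h + 1)" by (simp add: choose_two)
    then show ?thesis using \<open>c = 1\<close> by simp
  qed
  have "int (block_sign t n lam + (t choose 2) * (Suc n choose 2) + block_sign t n (\<lambda>_. 0)) + sign_exponent t n lam r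
    = int (c * n * (r + S + h * n) + T * (h + (t choose 2) + c) + 2 * (h * n))"
    unfolding e1 e2 e3 T_def[symmetric] by (simp add: algebra_simps)
  also have "even \<dots>"
    using ev1 ev2 by (metis dvd_add dvd_mult dvd_triv_left even_of_nat)
  finally show ?thesis .
qed

subsection \<open>The factorization theorem\<close>

lemma sp_numerator_eq:
  "det_of m (\<lambda>i j. y i powi (int (lam j) + int m - int j + 1) - y i powi (- (int (lam j) + int m - int j + 1)))
  = det_of m (\<lambda>i j. y i powi (int (beta lam m j) + 1) - y i powi (- (int (beta lam m j) + 1)))"
proof (rule det_of_cong)
  fix i j :: nat assume "1 \<le> j" "j \<le> m"
  then have "int (lam j) + int m - int j = int (beta lam m j)"
    by (simp add: beta_def of_nat_diff)
  then show "y i powi (int (lam j) + int m - int j + 1) - y i powi (- (int (lam j) + int m - int j + 1))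
    = y i powi (int (beta lam m j) + 1) - y i powi (- (int (beta lam m j) + 1))"
    by (simp only:)
qed

lemma empty_beta_list: "map (beta (\<lambda>_. 0) m) [1..<Suc m] = rev [0..<m]"
  by (rule nth_equalityI) (auto simp: beta_def rev_nth simp del: upt_Suc)

text \<open>For the denominator the sorting sign is computed explicitly by
  \<open>rearranges_residues\<close>.\<close>

lemma empty_twisted_cols:
  assumes "0 < t"
  shows "list_det f rs (map (beta (\<lambda>_. 0) (t * n)) [1..<Suc (t * n)])
    = (-1) ^ ((t choose 2) * (Suc n choose 2)) * list_det f rs (concat (map (block_col t (\<lambda>_. 0) (t * n)) [0..<t]))"
proof -
  have "map (block_col t (\<lambda>_. 0) (t * n)) [0..<t] = map (\<lambda>i. rev (map (\<lambda>q. t * q + i) [0..<n])) [0..<t]"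
    by (simp add: block_col_empty)
  then show ?thesis
    unfolding empty_beta_list by (simp only:) (rule list_det_rearrange_cols[OF rearranges_residues[OF assms]])
qed

text \<open>Products of quotients combine factor by factor, also where a denominator vanishes and
  division gives 0.\<close>

lemma quotient_numerator_ratio:
  assumes "2 \<le> t"
  shows "quotient_numerator t n x lam / quotient_numerator t n x (\<lambda>_. 0)
    = sp_char n (\<lambda>j. int (t_quotient t lam (t * n) (t - 1) j)) (\<lambda>i. x i ^ t)
      * (\<Prod>i<(t - 1) div 2. schur_char (2 * n) (mu1 t n lam i) (doubled_vars n t x))
      * (if even t
         then so_char n (\<lambda>j. int (t_quotient t lam (t * n) (t div 2 - 1) j)) (\<lambda>i. x i ^ t)
         else 1)"
  unfolding quotient_numerator_empty[OF assms] quotient_numerator_def[of t n x lam]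
    sp_char_def schur_char_def so_char_def prod_dividef
  by (simp only: times_divide_times_eq split: if_split) simp

theorem theorem2p11:
  fixes t n :: nat
    and \<omega> :: "'a::field"
    and x :: "nat \<Rightarrow> 'a"
    and lam \<kappa> \<sigma> :: "nat \<Rightarrow> nat"
  assumes "t \<ge> 2" and "n \<ge> 1"
    and "primitive_root_of_unity t \<omega>"
    and "is_partition lam" and "part_length lam \<le> t * n"
    and "t_core_of t lam \<kappa>"
    and "residue_sorting_perm t lam (t * n) \<sigma>"
    and "\<forall>i\<in>{1..n}. x i \<noteq> 0"
    and "sp_denom (t * n) (twisted_vars n \<omega> x) \<noteq> 0"
  shows "(\<not> symplectic_t_core t \<kappa> \<longrightarrow>
            sp_char (t * n) (\<lambda>j. int (lam j)) (twisted_vars n \<omega> x) = 0) \<and>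
         (symplectic_t_core t \<kappa> \<longrightarrow>
            sp_char (t * n) (\<lambda>j. int (lam j)) (twisted_vars n \<omega> x) =
              (-1) powi (sign_exponent t n lam (frob_rank \<kappa>)) * of_int (sign \<sigma>)
              * sp_char n (\<lambda>j. int (t_quotient t lam (t * n) (t - 1) j)) (\<lambda>i. x i ^ t)
              * (\<Prod>i<(t - 1) div 2. schur_char (2 * n) (mu1 t n lam i) (doubled_vars n t x))
              * (if even t
                 then so_char n (\<lambda>j. int (t_quotient t lam (t * n) (t div 2 - 1) j)) (\<lambda>i. x i ^ t)
                 else 1))"
proof -
  let ?m = "t * n" and ?e = "\<lambda>_::nat. 0::nat"
  have t0: "0 < t" and n0: "0 < n" using assms(1,2) by auto
  have x0: "x i \<noteq> 0" if "1 \<le> i" "i \<le> n" for i using assms(8) that by simp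
  have \<omega>: "\<omega> ^ t = 1" using assms(3) by (simp add: primitive_root_of_unity_def)
  have zero: "lam j = 0" if "?m < j" for j by (rule partition_zero[OF assms(4,5) that])
  have core: "is_t_core t \<kappa>" and steps: "(remove_border_strip t)\<^sup>*\<^sup>* lam \<kappa>"
    using assms(6) by (auto simp: t_core_of_def)
  have count: "residue_count t \<kappa> ?m = residue_count t lam ?m" and zero': "\<And>j. ?m < j \<Longrightarrow> \<kappa> j = 0"
    using remove_border_strips_residue_count[OF steps, of ?m] zero by (auto simp: fun_eq_iff)
  have sym: "symplectic_t_core t \<kappa> \<longleftrightarrow> balanced t n lam"
    using symplectic_core_iff[of t \<kappa> n, OF core assms(1) zero'] unfolding balanced_def count by blast
  define L where "L = list_det (twist_entry t x) (concat (map (block_row n) [0..<t]))"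
  obtain F where F: "\<And>g. det_of ?m (\<lambda>i j. twisted_vars n \<omega> x i powi (int (g j) + 1)
      - twisted_vars n \<omega> x i powi (- (int (g j) + 1))) = F * L (map g [1..<Suc ?m])"
    unfolding L_def by (rule twisted_det_factor[OF \<omega> t0 n0]) blast
  have den: "sp_denom ?m (twisted_vars n \<omega> x) = F * L (map (beta ?e ?m) [1..<Suc ?m])"
    using F[of "beta ?e ?m"] sp_numerator_eq[of ?m "twisted_vars n \<omega> x" ?e] by (simp add: sp_denom_def)
  have char: "sp_char ?m (\<lambda>j. int (lam j)) (twisted_vars n \<omega> x)
      = F * L (map (beta lam ?m) [1..<Suc ?m]) / (F * L (map (beta ?e ?m) [1..<Suc ?m]))"
    unfolding sp_char_def den sp_numerator_eq F ..
  show ?thesis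
  proof (intro conjI impI)
    assume "\<not> symplectic_t_core t \<kappa>"
    then have "L (map (beta lam ?m) [1..<Suc ?m]) = 0"
      unfolding L_def sym balanced_def by (intro twisted_det_zero[OF assms(4,1) n0])
    then show "sp_char ?m (\<lambda>j. int (lam j)) (twisted_vars n \<omega> x) = 0"
      unfolding char by simp
  next
    assume S: "symplectic_t_core t \<kappa>"
    then have bal: "balanced t n lam" using sym by simp
    obtain K where K: "\<And>lam. balanced t n lam \<Longrightarrow> L (concat (map (block_col t lam ?m) [0..<t]))
        = K * (-1) ^ block_sign t n lam * quotient_numerator t n x lam"
      unfolding L_def using twisted_det_eval[of n x t, OF x0 assms(1)] by metis
    define s :: 'a where "s = of_int (sign \<sigma>)"
    \<comment> \<open>Lets the sign of \<open>\<sigma>\<close> pass to the other side of the sorting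
      identity.\<close>
    have s2: "s * s = 1" by (simp add: s_def flip: of_int_mult)
    have \<sigma>: "\<sigma> permutes {1..?m}" using assms(7) by (simp add: residue_sorting_perm_def)
    have "length (concat (map (block_row n) [0..<t])) = ?m"
      unfolding concat_block_rows[OF n0] by simp
    then have "L (concat (map (block_col t lam ?m) [0..<t])) = s * L (map (beta lam ?m) [1..<Suc ?m])"
      unfolding L_def s_def sorting_perm_cols[OF assms(7) t0, symmetric]
      by (rule list_det_permute_cols[OF \<sigma>])
    then have num: "L (map (beta lam ?m) [1..<Suc ?m])
        = s * (K * (-1) ^ block_sign t n lam * quotient_numerator t n x lam)"
      unfolding K[OF bal, symmetric] by (simp add: s2 flip: mult.assoc)
    define a where "a = (t choose 2) * (Suc n choose 2)"
    have emp: "L (map (beta ?e ?m) [1..<Suc ?m])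
        = (-1) ^ a * (K * (-1) ^ block_sign t n ?e * quotient_numerator t n x ?e)"
      unfolding K[OF balanced_empty[OF assms(1)], symmetric] unfolding L_def a_def
      by (rule empty_twisted_cols[OF t0])
    \<comment> \<open>Both divide the symplectic denominator, which is non-zero by
      assumption.\<close>
    have "F \<noteq> 0" "K \<noteq> 0"
      using assms(9) unfolding den emp by auto
    define Q where "Q = quotient_numerator t n x lam / quotient_numerator t n x ?e"
    have "sp_char ?m (\<lambda>j. int (lam j)) (twisted_vars n \<omega> x)
        = (-1) ^ (block_sign t n lam + a + block_sign t n ?e) * s * Q"
      unfolding char num emp Q_def using \<open>F \<noteq> 0\<close> \<open>K \<noteq> 0\<close>
      by (simp add: minus_one_power_iff)
    also have "(-1) ^ (block_sign t n lam + a + block_sign t n ?e)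
        = ((-1) powi sign_exponent t n lam (frob_rank \<kappa>) :: 'a)"
    proof -
      \<comment> \<open>The parity of the rank is known in terms of the counts of
        \<open>\<kappa>\<close>, which are those of \<open>lam\<close>.\<close>
      have "even (frob_rank \<kappa> + (\<Sum>i<(t - 1) div 2. residue_count t lam ?m (t - 2 - i) + n))"
        using symplectic_core_rank_parity[of t \<kappa> n, OF core assms(1) zero' S] unfolding count .
      then have "even (int (block_sign t n lam + a + block_sign t n ?e) + sign_exponent t n lam (frob_rank \<kappa>))"
        unfolding a_def by (rule sign_exponent_parity[OF assms(1)])
      then have "even (block_sign t n lam + a + block_sign t n ?e) = even (sign_exponent t n lam (frob_rank \<kappa>))"
        by (metis even_add even_of_nat)
      then show ?thesis
        by (simp only: minus_one_power_iff power_int_minus_left power_int_1_left)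
    qed
    finally show "sp_char ?m (\<lambda>j. int (lam j)) (twisted_vars n \<omega> x) =
              (-1) powi (sign_exponent t n lam (frob_rank \<kappa>)) * of_int (sign \<sigma>)
              * sp_char n (\<lambda>j. int (t_quotient t lam (t * n) (t - 1) j)) (\<lambda>i. x i ^ t)
              * (\<Prod>i<(t - 1) div 2. schur_char (2 * n) (mu1 t n lam i) (doubled_vars n t x))
              * (if even t
                 then so_char n (\<lambda>j. int (t_quotient t lam (t * n) (t div 2 - 1) j)) (\<lambda>i. x i ^ t)
                 else 1)"
      unfolding Q_def quotient_numerator_ratio[OF assms(1)] s_def by (simp only: mult.assoc)
  qed
qed

end
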